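(* Let $\bar\xi=\sum_{d=1}^S w_d\bar\xi_d$ be an invariant design with $h_r(\bar\xi)>0$ for $r=1,2,3$ (so that $\mathbf{M}(\bar\xi)$ is nonsingular). Then the variance function $V((\mathbf{i},\mathbf{j}),\bar\xi)=(\mathbf{f}(\mathbf{i})-\mathbf{f}(\mathbf{j}))^\top\mathbf{M}(\bar\xi)^{-1}(\mathbf{f}(\mathbf{i})-\mathbf{f}(\mathbf{j}))$ is constant on each $\mathcal{X}^{(S)}_d$, and its value $V(d,\bar\xi)$ on $\mathcal{X}^{(S)}_d$ is $$V(d,\bar\xi)=d(v-1)\Big(\frac{1}{h_1(\bar\xi)}+\frac{v-1}{4v\,h_2(\bar\xi)}(2Sv-2S-dv-v+2)+\frac{(v-1)^2}{24v^2h_3(\bar\xi)}\lambda(d)\Big).$$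
   Context: Fix integers $v\ge 2$, $K\ge 3$ and $S$ with $3\le S\le K$. Let $\mathbf{e}_i$ denote the $i$th unit vector of $\mathbb{R}^{v-1}$ and $\mathbf{1}_{v-1}$ the all-ones vector. Define $\mathbf{f}_1:\{0,1,\dots,v\}\to\mathbb{R}^{v-1}$ by $\mathbf{f}_1(i)=\mathbf{e}_i$ for $1\le i\le v-1$, $\mathbf{f}_1(v)=-\mathbf{1}_{v-1}$, $\mathbf{f}_1(0)=\mathbf{0}$. For $\mathbf{i}\in\{0,\dots,v\}^K$ let $\mathbf{f}(\mathbf{i})\in\mathbb{R}^p$ stack $\mathbf{f}_1(i_k)$ ($k=1,\dots,K$), then $\mathbf{f}_1(i_k)\otimes\mathbf{f}_1(i_\ell)$ ($k<\ell$, lexicographic), then $\mathbf{f}_1(i_k)\otimes\mathbf{f}_1(i_\ell)\otimes\mathbf{f}_1(i_m)$ ($k<\ell<m$, lexicographic); $p=K(v-1)+\binom K2(v-1)^2+\binom K3(v-1)^3$. The design region $\mathcal{X}^{(S)}$ is the set of ordered pairs $(\mathbf{i},\mathbf{j})$ in $\{0,\dots,v\}^K$ for which there is a set $A$ of exactly $S$ attributes with $i_k,j_k\in\{1,\dots,v\}$ for $k\in A$ and $i_k=j_k=0$ for $k\notin A$; $\mathcal{X}^{(S)}_d$ is the subset with $i_k\ne j_k$ for exactly $d$ indices $k$. An approximate design is a finitely supported probability measure $\xi$ on $\mathcal{X}^{(S)}$ with information matrix $\mathbf{M}(\xi)=\sum\xi(\mathbf{i},\mathbf{j})(\mathbf{f}(\mathbf{i})-\mathbf{f}(\mathbf{j}))(\mathbf{f}(\mathbf{i})-\mathbf{f}(\mathbf{j}))^\top$;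 $\bar\xi_d$ is the uniform design on $\mathcal{X}^{(S)}_d$, and a design of the form $\sum_{d=1}^S w_d\bar\xi_d$ ($w_d\ge0$, $\sum w_d=1$) is called invariant. Define $\lambda(d)=3S^2+3S^2v^2-6S^2v-3Sdv^2+3Sdv-6Sv^2+15Sv-9S+d^2v^2+3dv^2-6dv+2v^2-6v+6$, $h_1(d)=d/K$, $h_2(d)=\frac{d}{2vK(K-1)}(2Sv-2S-dv-v+2)$, $h_3(d)=\frac{d\lambda(d)}{4v^2K(K-1)(K-2)}$, and $h_r(\bar\xi)=\sum_{d=1}^S w_d h_r(d)$. *)

theory Defs
  imports "Jordan_Normal_Form.Matrix"
begin

text \<open>Profiles i in {0,..,v}^K are lists of length K; attribute k is position k (0-based).\<close>

definition profiles :: "nat \<Rightarrow> nat \<Rightarrow> nat list set" where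
  "profiles v K = {xs. length xs = K \<and> set xs \<subseteq> {0..v}}"

definition f1 :: "nat \<Rightarrow> nat \<Rightarrow> real list" where
  "f1 v i = map (\<lambda>a. if i = v then -1 else if i = a + 1 then 1 else 0) [0..<v-1]"

definition kron :: "real list \<Rightarrow> real list \<Rightarrow> real list" where
  "kron u w = concat (map (\<lambda>x. map (\<lambda>y. x * y) w) u)"

definition pairs_lex :: "nat \<Rightarrow> (nat \<times> nat) list" where
  "pairs_lex K = concat (map (\<lambda>k. map (\<lambda>l. (k, l)) [Suc k..<K]) [0..<K])"

definition triples_lex :: "nat \<Rightarrow> (nat \<times> nat \<times> nat) list" where
  "triples_lex K = concat (map (\<lambda>k. concat (map (\<lambda>l. map (\<lambda>m. (k, l, m)) [Suc l..<K]) [Suc k..<K])) [0..<K])"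

definition fvec :: "nat \<Rightarrow> nat \<Rightarrow> nat list \<Rightarrow> real vec" where
  "fvec v K i = vec_of_list
     (concat (map (\<lambda>k. f1 v (i ! k)) [0..<K])
      @ concat (map (\<lambda>(k, l). kron (f1 v (i ! k)) (f1 v (i ! l))) (pairs_lex K))
      @ concat (map (\<lambda>(k, l, m). kron (kron (f1 v (i ! k)) (f1 v (i ! l))) (f1 v (i ! m))) (triples_lex K)))"

definition pdim :: "nat \<Rightarrow> nat \<Rightarrow> nat" where
  "pdim v K = K * (v - 1) + (K choose 2) * (v - 1) ^ 2 + (K choose 3) * (v - 1) ^ 3"

definition region :: "nat \<Rightarrow> nat \<Rightarrow> nat \<Rightarrow> (nat list \<times> nat list) set" where
  "region v K S = {(i, j). i \<in> profiles v K \<and> j \<in> profiles v K \<and>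
     (\<exists>A. A \<subseteq> {0..<K} \<and> card A = S \<and>
        (\<forall>k\<in>A. i ! k \<in> {1..v} \<and> j ! k \<in> {1..v}) \<and>
        (\<forall>k\<in>{0..<K} - A. i ! k = 0 \<and> j ! k = 0))}"

definition ndiff :: "nat list \<Rightarrow> nat list \<Rightarrow> nat" where
  "ndiff i j = card {k \<in> {0..<length i}. i ! k \<noteq> j ! k}"

definition region_d :: "nat \<Rightarrow> nat \<Rightarrow> nat \<Rightarrow> nat \<Rightarrow> (nat list \<times> nat list) set" where
  "region_d v K S d = {x \<in> region v K S. ndiff (fst x) (snd x) = d}"

definition gvec :: "nat \<Rightarrow> nat \<Rightarrow> nat list \<times> nat list \<Rightarrow> real vec" where
  "gvec v K x = fvec v K (fst x) - fvec v K (snd x)"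

definition info_mat :: "nat \<Rightarrow> nat \<Rightarrow> nat \<Rightarrow> (nat list \<times> nat list \<Rightarrow> real) \<Rightarrow> real mat" where
  "info_mat v K S \<xi> = mat (pdim v K) (pdim v K)
     (\<lambda>(r, c). \<Sum>x\<in>region v K S. \<xi> x * (gvec v K x $ r) * (gvec v K x $ c))"

definition unif_d :: "nat \<Rightarrow> nat \<Rightarrow> nat \<Rightarrow> nat \<Rightarrow> nat list \<times> nat list \<Rightarrow> real" where
  "unif_d v K S d x = (if x \<in> region_d v K S d then 1 / real (card (region_d v K S d)) else 0)"

definition inv_design :: "nat \<Rightarrow> nat \<Rightarrow> nat \<Rightarrow> (nat \<Rightarrow> real) \<Rightarrow> nat list \<times> nat list \<Rightarrow> real" where
  "inv_design v K S w x = (\<Sum>d=1..S. w d * unif_d v K S d x)"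

definition lam :: "nat \<Rightarrow> nat \<Rightarrow> nat \<Rightarrow> real" where
  "lam v S d' = (let S = real S; v = real v; d = real d' in
     3*S^2 + 3*S^2*v^2 - 6*S^2*v - 3*S*d*v^2 + 3*S*d*v - 6*S*v^2 + 15*S*v - 9*S
     + d^2*v^2 + 3*d*v^2 - 6*d*v + 2*v^2 - 6*v + 6)"

definition h1 :: "nat \<Rightarrow> nat \<Rightarrow> nat \<Rightarrow> nat \<Rightarrow> real" where
  "h1 v K S d = real d / real K"

definition h2 :: "nat \<Rightarrow> nat \<Rightarrow> nat \<Rightarrow> nat \<Rightarrow> real" where
  "h2 v K S d = real d / (2 * real v * real K * (real K - 1))
     * (2 * real S * real v - 2 * real S - real d * real v - real v + 2)"

definition h3 :: "nat \<Rightarrow> nat \<Rightarrow> nat \<Rightarrow> nat \<Rightarrow> real" where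
  "h3 v K S d = real d * lam v S d / (4 * (real v)^2 * real K * (real K - 1) * (real K - 2))"

definition hbar :: "(nat \<Rightarrow> nat \<Rightarrow> nat \<Rightarrow> nat \<Rightarrow> real) \<Rightarrow> nat \<Rightarrow> nat \<Rightarrow> nat \<Rightarrow> (nat \<Rightarrow> real) \<Rightarrow> real" where
  "hbar h v K S w = (\<Sum>d=1..S. w d * h v K S d)"

end

theory Submission
  imports Defs "Jordan_Normal_Form.Determinant" "HOL-Library.FuncSet"
begin

text \<open>
  Index the coordinates of \<open>fvec\<close> by labels \<open>u\<close>, functions from the attributes to \<open>{0..v-1}\<close> that are
  nonzero on one, two or three attributes; \<open>u k = 0\<close> says that attribute \<open>k\<close> does not take part. Each
  coordinate is then a product over all attributes. The set of pairs with comparison depth \<open>d\<close> is a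
  disjoint union, over the possible sets \<open>A\<close> of active and \<open>D\<close> of differing attributes, of products
  over the attributes, so the second moments factorise: the entry of the information matrix at
  \<open>(u, u')\<close> is a constant times the product of the entries of \<open>I + J\<close> over the common support of \<open>u\<close> and
  \<open>u'\<close>, and \<open>0\<close> if the supports differ. The constant depends on the support only through its size \<open>r\<close>,
  because attributes can be permuted. Averaging over all supports of size \<open>r\<close> therefore identifies it
  with a difference of elementary symmetric polynomials. Up to scaling, the same difference is the
  degree-\<open>r\<close> part of the variance function, since \<open>(I + J)\<close> has the inverse \<open>I - J/v\<close>.
\<close>

section \<open>Labels\<close>

text \<open>For 0 < \<open>a\<close> < \<open>v\<close> this is the coordinate of \<open>f1\<close>
  that belongs to level \<open>a\<close>. The value 1 at \<open>a = 0\<close> is the neutral factor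
  of an attribute that does not take part.\<close>

definition lev :: "nat \<Rightarrow> nat \<Rightarrow> nat \<Rightarrow> real" where
  "lev v x a = (if a = 0 then 1 else if x = v then -1 else if x = a then 1 else 0)"

definition effect :: "nat \<Rightarrow> nat \<Rightarrow> nat list \<Rightarrow> (nat \<Rightarrow> nat) \<Rightarrow> real" where
  "effect v K x u = (\<Prod>k<K. lev v (x ! k) (u k))"

definition supp :: "nat \<Rightarrow> (nat \<Rightarrow> nat) \<Rightarrow> nat set" where
  "supp K u = {k. k < K \<and> u k \<noteq> 0}"

text \<open>Extensionality makes a label determined by its values on the \<open>K\<close>
  attributes, and a sum over the surrounding function space distributes over the attributes. Support
  sizes 1, 2 and 3 are the main effects, the pairs and the triples.\<close>

definition labels :: "nat \<Rightarrow> nat \<Rightarrow> (nat \<Rightarrow> nat) set" where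
  "labels v K = {u \<in> {..<K} \<rightarrow>\<^sub>E {..<v}. card (supp K u) \<in> {1..3}}"

text \<open>The elementary symmetric polynomial of degree \<open>r\<close>. A general semiring
  allows both counting over \<open>nat\<close> and evaluation of real moments.\<close>

definition esym :: "'a set \<Rightarrow> ('a \<Rightarrow> 'b::comm_semiring_1) \<Rightarrow> nat \<Rightarrow> 'b" where
  "esym B x r = (\<Sum>T | T \<subseteq> B \<and> card T = r. \<Prod>k\<in>T. x k)"

lemma finite_supp [simp]: "finite (supp K u)"
  by (simp add: supp_def)

lemma supp_subset: "supp K u \<subseteq> {..<K}"
  by (auto simp: supp_def)

lemma finite_labels [simp]: "finite (labels v K)"
  unfolding labels_def by (rule finite_subset[of _ "{..<K} \<rightarrow>\<^sub>E {..<v}"]) (auto intro: finite_PiE)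

lemma prod_restrict_support:
  fixes f :: "nat \<Rightarrow> 'b::comm_monoid_mult"
  assumes "T \<subseteq> {..<K}"
  shows "(\<Prod>k<K. if k \<in> T then f k else 1) = (\<Prod>k\<in>T. f k)"
  using assms by (simp add: prod.If_cases Int_absorb1)

text \<open>Group the labels by support \<open>T\<close>. Those with support \<open>T\<close> form a
  product set: the single choice 0 outside \<open>T\<close>, where the factor is 1, and the choices
  1 to v - 1 inside. Exchanging sum and product leaves one monomial per \<open>T\<close>, and the
  supports of size \<open>r\<close> collect into \<open>esym\<close>.\<close>

lemma sum_labels_by_support:
  fixes \<theta> :: "nat \<Rightarrow> nat \<Rightarrow> 'b::comm_semiring_1"
  assumes v: "v \<ge> 1" and \<theta>0: "\<And>k. k < K \<Longrightarrow> \<theta> k 0 = 1"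
  shows "(\<Sum>u\<in>labels v K. C (card (supp K u)) * (\<Prod>k<K. \<theta> k (u k)))
       = (\<Sum>r=1..3. C r * esym {..<K} (\<lambda>k. \<Sum>b=1..<v. \<theta> k b) r)"
proof -
  let ?TT = "{T. T \<subseteq> {..<K} \<and> card T \<in> {1..3}}"
  have finTT: "finite ?TT" by simp
  have fib: "(\<Sum>u | u \<in> labels v K \<and> supp K u = T. C (card (supp K u)) * (\<Prod>k<K. \<theta> k (u k)))
      = C (card T) * (\<Prod>k\<in>T. \<Sum>b=1..<v. \<theta> k b)" if T: "T \<in> ?TT" for T
  proof -
    let ?B = "\<lambda>k. if k \<in> T then {1..<v} else {0}"
    have set_eq: "{u \<in> labels v K. supp K u = T} = PiE {..<K} ?B"
    proof (intro equalityI subsetI)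
      fix u assume "u \<in> {u \<in> labels v K. supp K u = T}"
      then have u: "u \<in> {..<K} \<rightarrow>\<^sub>E {..<v}" "supp K u = T" by (auto simp: labels_def)
      show "u \<in> PiE {..<K} ?B"
      proof (rule PiE_I)
        fix k assume k: "k \<in> {..<K}"
        then have "u k < v" using u(1) by auto
        then show "u k \<in> ?B k" using k u(2) by (auto simp: supp_def)
      next
        fix k assume "k \<notin> {..<K}" then show "u k = undefined" using u(1) by auto
      qed
    next
      fix u assume u: "u \<in> PiE {..<K} ?B"
      have uk: "u k \<in> ?B k" if "k < K" for k 
        using PiE_mem[OF u, of k] that by simp
      have "u k \<noteq> 0 \<longleftrightarrow> k \<in> T" if "k < K" for k using uk[OF that] by (auto split: if_splits)
      then have "supp K u = T" using T by (auto simp: supp_def)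
      moreover have "u \<in> {..<K} \<rightarrow>\<^sub>E {..<v}"
      proof (rule PiE_I)
        fix k assume k: "k \<in> {..<K}"
        then show "u k \<in> {..<v}" using uk[of k] v by (auto split: if_splits)
      next
        fix k assume "k \<notin> {..<K}" then show "u k = undefined" using u by auto
      qed
      ultimately show "u \<in> {u \<in> labels v K. supp K u = T}" using T by (auto simp: labels_def)
    qed
    have "(\<Sum>u | u \<in> labels v K \<and> supp K u = T. C (card (supp K u)) * (\<Prod>k<K. \<theta> k (u k)))
        = C (card T) * (\<Sum>u\<in>PiE {..<K} ?B. \<Prod>k<K. \<theta> k (u k))"
      unfolding sum_distrib_left set_eq[symmetric] by (rule sum.cong) auto
    also have "(\<Sum>u\<in>PiE {..<K} ?B. \<Prod>k<K. \<theta> k (u k)) = (\<Prod>k<K. \<Sum>b\<in>?B k. \<theta> k b)"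
      by (rule prod_sum_PiE[symmetric]) auto
    also have "\<dots> = (\<Prod>k<K. if k \<in> T then \<Sum>b=1..<v. \<theta> k b else 1)"
      by (rule prod.cong) (auto simp: \<theta>0)
    also have "\<dots> = (\<Prod>k\<in>T. \<Sum>b=1..<v. \<theta> k b)"
      using T by (intro prod_restrict_support) auto
    finally show ?thesis .
  qed
  have "(\<Sum>u\<in>labels v K. C (card (supp K u)) * (\<Prod>k<K. \<theta> k (u k)))
      = (\<Sum>T\<in>?TT. \<Sum>u | u \<in> labels v K \<and> supp K u = T. C (card (supp K u)) * (\<Prod>k<K. \<theta> k (u k)))"
  proof (rule sum.group[symmetric])
    show "supp K ` labels v K \<subseteq> ?TT" by (auto simp: labels_def supp_def)
  qed (simp_all add: finTT)
  also have "\<dots> = (\<Sum>T\<in>?TT. C (card T) * (\<Prod>k\<in>T. \<Sum>b=1..<v. \<theta> k b))"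
    by (rule sum.cong[OF refl]) (rule fib)
  also have "\<dots> = (\<Sum>r\<in>{1..3}. \<Sum>T | T \<in> ?TT \<and> card T = r. C (card T) * (\<Prod>k\<in>T. \<Sum>b=1..<v. \<theta> k b))"
    by (rule sum.group[symmetric]) (use finTT in auto)
  also have "\<dots> = (\<Sum>r=1..3. C r * esym {..<K} (\<lambda>k. \<Sum>b=1..<v. \<theta> k b) r)"
    unfolding esym_def sum_distrib_left by (intro sum.cong) auto
  finally show ?thesis .
qed

text \<open>All weights are 1 in the preceding lemma. The count is what later shows that
  \<open>label_list\<close> has no repetitions.\<close>

lemma card_labels:
  assumes "v \<ge> 1"
  shows "card (labels v K) = pdim v K"
proof -
  have "card (labels v K) = (\<Sum>u\<in>labels v K. 1 * (\<Prod>k<K. 1))" by simp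
  also have "\<dots> = (\<Sum>r=1..3. 1 * esym {..<K} (\<lambda>k. \<Sum>b=1..<v. 1) r)"
    by (rule sum_labels_by_support[OF assms, where C = "\<lambda>_. 1"]) simp
  also have "\<dots> = (\<Sum>r=1..3. (K choose r) * (v - 1) ^ r)"
  proof (rule sum.cong[OF refl])
    fix r :: nat
    have "esym {..<K} (\<lambda>k. \<Sum>b=1..<v. 1) r = (\<Sum>T | T \<subseteq> {..<K} \<and> card T = r. (v - 1) ^ r)"
      unfolding esym_def by (rule sum.cong) auto
    then show "1 * esym {..<K} (\<lambda>k. \<Sum>b=1..<v. 1) r = (K choose r) * (v - 1) ^ r"
      using n_subsets[of "{..<K}" r] by simp
  qed
  also have "\<dots> = pdim v K"
    by (simp add: pdim_def numeral_eq_Suc)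
  finally show ?thesis .
qed

section \<open>Elementary symmetric polynomials\<close>

lemma esym_0: "finite B \<Longrightarrow> esym B x 0 = 1"
proof -
  assume "finite B"
  then have "{T. T \<subseteq> B \<and> card T = 0} = {{}}" by (auto dest: finite_subset)
  then show ?thesis by (simp add: esym_def)
qed

lemma esym_empty_Suc: "esym ({} :: 'a set) x (Suc r) = 0"
proof -
  have "{T :: 'a set. T \<subseteq> {} \<and> card T = Suc r} = {}" by auto
  then show ?thesis unfolding esym_def by (simp only: sum.empty)
qed

text \<open>A subset of \<open>insert b B\<close> with r + 1 elements either avoids \<open>b\<close>
  or arises from exactly one \<open>r\<close>-subset of \<open>B\<close> by adding
  \<open>b\<close>.\<close>

lemma esym_insert:
  assumes "finite B" "b \<notin> B"
  shows "esym (insert b B) x (Suc r) = esym B x (Suc r) + x b * esym B x r"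
proof -
  let ?L = "{T. T \<subseteq> B \<and> card T = Suc r}" and ?R = "{T. T \<subseteq> B \<and> card T = r}"
  have fin: "finite T" if "T \<subseteq> insert b B" for T
    using that assms(1) by (meson finite_insert finite_subset)
  have split: "{T. T \<subseteq> insert b B \<and> card T = Suc r} = ?L \<union> insert b ` ?R"
  proof (intro equalityI subsetI)
    fix T assume T: "T \<in> {T. T \<subseteq> insert b B \<and> card T = Suc r}"
    show "T \<in> ?L \<union> insert b ` ?R"
    proof (cases "b \<in> T")
      case True
      then have "T = insert b (T - {b})" "T - {b} \<in> ?R" using T fin by auto
      then show ?thesis by blast
    qed (use T in auto)
  next
    fix T assume "T \<in> ?L \<union> insert b ` ?R"
    then show "T \<in> {T. T \<subseteq> insert b B \<and> card T = Suc r}"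
      using assms fin by (auto simp: card_insert_if subset_insertI2)
  qed
  have inj: "inj_on (insert b) ?R"
    using assms(2) by (intro inj_onI) (metis (no_types, lifting) insert_ident mem_Collect_eq subset_iff)
  have "esym (insert b B) x (Suc r) = (\<Sum>T\<in>?L. \<Prod>k\<in>T. x k) + (\<Sum>T\<in>insert b ` ?R. \<Prod>k\<in>T. x k)"
    unfolding esym_def split using assms by (intro sum.union_disjoint) auto
  also have "(\<Sum>T\<in>insert b ` ?R. \<Prod>k\<in>T. x k) = (\<Sum>T\<in>?R. x b * (\<Prod>k\<in>T. x k))"
    unfolding sum.reindex[OF inj] o_def
    using assms fin by (intro sum.cong refl prod.insert) auto
  finally show ?thesis unfolding esym_def by (simp add: sum_distrib_left)
qed

lemma esym_1:
  assumes "finite B"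
  shows "esym B x 1 = sum x B"
  using assms
proof (induction B rule: finite_induct)
  case empty
  then show ?case using esym_empty_Suc[of x 0] by simp
next
  case (insert b B)
  then show ?case using esym_insert[OF insert.hyps, of x 0] by (simp add: esym_0 add.commute)
qed

text \<open>Newton's identities, here and for degree 3, reduce \<open>esym\<close> to power sums.
  These are easy to evaluate for a function with few values, such as \<open>rho\<close>
  below.\<close>

lemma esym_2:
  fixes x :: "'a \<Rightarrow> real"
  assumes "finite B"
  shows "2 * esym B x 2 = (sum x B)\<^sup>2 - (\<Sum>k\<in>B. (x k)\<^sup>2)"
  using assms
proof (induction B rule: finite_induct)
  case empty
  then show ?case using esym_empty_Suc[of x 1] by (simp add: numeral_2_eq_2)
next
  case (insert b B)
  have "esym (insert b B) x 2 = esym B x 2 + x b * sum x B"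
    using esym_insert[OF insert.hyps, of x 1] esym_1[OF insert.hyps(1), of x] by (simp add: numeral_2_eq_2)
  then show ?case using insert by (simp add: power2_eq_square algebra_simps)
qed

lemma esym_3:
  fixes x :: "'a \<Rightarrow> real"
  assumes "finite B"
  shows "6 * esym B x 3 = (sum x B) ^ 3 - 3 * sum x B * (\<Sum>k\<in>B. (x k)\<^sup>2) + 2 * (\<Sum>k\<in>B. (x k) ^ 3)"
  using assms
proof (induction B rule: finite_induct)
  case empty
  then show ?case using esym_empty_Suc[of x 2] by (simp add: numeral_3_eq_3)
next
  case (insert b B)
  have "esym (insert b B) x 3 = esym B x 3 + x b * esym B x 2"
    using esym_insert[OF insert.hyps, of x 2] by (simp add: numeral_3_eq_3 numeral_2_eq_2)
  then have "6 * esym (insert b B) x 3 = 6 * esym B x 3 + 3 * x b * (2 * esym B x 2)" by simp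
  then show ?case using insert esym_2[OF insert.hyps(1), of x]
    by (simp add: power2_eq_square power3_eq_cube algebra_simps)
qed

section \<open>Coordinates of the regression vector\<close>

text \<open>Turns a short list of (attribute, level) pairs into a full extensional label, with 0 at
  the unlisted attributes.\<close>

definition lab :: "nat \<Rightarrow> (nat \<times> nat) list \<Rightarrow> nat \<Rightarrow> nat" where
  "lab K ps = (\<lambda>k\<in>{..<K}. case map_of ps k of None \<Rightarrow> 0 | Some a \<Rightarrow> a)"

text \<open>The order is that in which \<open>fvec\<close> stacks its coordinates. The shift by
  \<open>Suc\<close> appears because position \<open>a\<close> of \<open>f1\<close> belongs to level
  a + 1.\<close>

definition label_list :: "nat \<Rightarrow> nat \<Rightarrow> (nat \<Rightarrow> nat) list" where
  "label_list v K =
     concat (map (\<lambda>k. map (\<lambda>a. lab K [(k, Suc a)]) [0..<v-1]) [0..<K])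
     @ concat (map (\<lambda>(k, l). map (\<lambda>(a, b). lab K [(k, Suc a), (l, Suc b)])
         (List.product [0..<v-1] [0..<v-1])) (pairs_lex K))
     @ concat (map (\<lambda>(k, l, m). map (\<lambda>((a, b), c). lab K [(k, Suc a), (l, Suc b), (m, Suc c)])
         (List.product (List.product [0..<v-1] [0..<v-1]) [0..<v-1])) (triples_lex K))"

text \<open>Unlisted attributes carry 0 in the label and contribute the factor 1; distinct keys
  ensure that \<open>map_of\<close> returns the listed level.\<close>

lemma effect_lab:
  assumes "distinct (map fst ps)" "fst ` set ps \<subseteq> {..<K}"
  shows "effect v K x (lab K ps) = (\<Prod>(k, a)\<leftarrow>ps. lev v (x ! k) a)"
proof -
  have "effect v K x (lab K ps) = (\<Prod>k\<in>fst ` set ps. lev v (x ! k) (lab K ps k))"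
    unfolding effect_def using assms(2)
    by (intro prod.mono_neutral_right)
      (auto simp: lab_def lev_def map_of_eq_None_iff split: option.splits dest: map_of_SomeD intro: rev_image_eqI)
  also have "\<dots> = (\<Prod>k\<leftarrow>map fst ps. lev v (x ! k) (lab K ps k))"
    using prod.distinct_set_conv_list[OF assms(1)] by simp
  also have "\<dots> = (\<Prod>(k, a)\<leftarrow>ps. lev v (x ! k) a)"
  proof -
    have "lab K ps k = a" if "(k, a) \<in> set ps" for k a
    proof -
      have "k < K" using that assms(2) by force
      then show ?thesis using map_of_is_SomeI[OF assms(1) that] by (simp add: lab_def)
    qed
    then have "map (\<lambda>k. lev v (x ! k) (lab K ps k)) (map fst ps) = map (\<lambda>(k, a). lev v (x ! k) a) ps"
      by auto
    then show ?thesis by (rule arg_cong)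
  qed
  finally show ?thesis .
qed

lemma f1_lev: "f1 v i = map (\<lambda>a. lev v i (Suc a)) [0..<v-1]"
  by (auto simp: f1_def lev_def)

text \<open>The Kronecker product and \<open>List.product\<close> both run through the second index
  fastest.\<close>

lemma kron_map:
  "kron (map f xs) (map g ys) = map (\<lambda>(a, b). f a * g b) (List.product xs ys)"
  by (induction xs) (simp_all add: kron_def comp_def)

lemma pairs_lex_bounds: "(k, l) \<in> set (pairs_lex K) \<longleftrightarrow> k < l \<and> l < K"
  by (force simp: pairs_lex_def)

lemma triples_lex_bounds: "(k, l, m) \<in> set (triples_lex K) \<longleftrightarrow> k < l \<and> l < m \<and> m < K"
proof -
  have "(k, l, m) \<in> set (triples_lex K)
      \<longleftrightarrow> (\<exists>x\<in>{0..<K}. \<exists>y\<in>{Suc x..<K}. \<exists>z\<in>{Suc y..<K}. k = x \<and> l = y \<and> m = z)"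
    by (simp add: triples_lex_def image_iff)
  then show ?thesis by auto
qed

text \<open>The three blocks are compared separately: \<open>kron_map\<close> names each coordinate
  by its indices, and \<open>effect_lab\<close> recognises the product as the effect of a
  label.\<close>

lemma fvec_label_list: "fvec v K x = vec_of_list (map (effect v K x) (label_list v K))"
proof -
  have 1: "concat (map (\<lambda>k. f1 v (x ! k)) [0..<K])
     = map (effect v K x) (concat (map (\<lambda>k. map (\<lambda>a. lab K [(k, Suc a)]) [0..<v-1]) [0..<K]))"
    unfolding map_concat map_map
    by (intro arg_cong[where f = concat] map_cong refl) (auto simp: f1_lev effect_lab)
  have 2: "concat (map (\<lambda>(k, l). kron (f1 v (x ! k)) (f1 v (x ! l))) (pairs_lex K))
     = map (effect v K x) (concat (map (\<lambda>(k, l). map (\<lambda>(a, b). lab K [(k, Suc a), (l, Suc b)])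
         (List.product [0..<v-1] [0..<v-1])) (pairs_lex K)))"
    unfolding map_concat map_map
  proof (intro arg_cong[where f = concat] map_cong refl)
    fix z assume "z \<in> set (pairs_lex K)"
    then show "(case z of (k, l) \<Rightarrow> kron (f1 v (x ! k)) (f1 v (x ! l)))
      = (map (effect v K x) \<circ> (\<lambda>(k, l). map (\<lambda>(a, b). lab K [(k, Suc a), (l, Suc b)])
         (List.product [0..<v-1] [0..<v-1]))) z"
      by (auto simp: f1_lev kron_map effect_lab pairs_lex_bounds split: prod.splits)
  qed
  have 3: "concat (map (\<lambda>(k, l, m). kron (kron (f1 v (x ! k)) (f1 v (x ! l))) (f1 v (x ! m))) (triples_lex K))
     = map (effect v K x) (concat (map (\<lambda>(k, l, m). map (\<lambda>((a, b), c). lab K [(k, Suc a), (l, Suc b), (m, Suc c)])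
         (List.product (List.product [0..<v-1] [0..<v-1]) [0..<v-1])) (triples_lex K)))"
    unfolding map_concat map_map
  proof (intro arg_cong[where f = concat] map_cong refl)
    fix z assume "z \<in> set (triples_lex K)"
    then show "(case z of (k, l, m) \<Rightarrow> kron (kron (f1 v (x ! k)) (f1 v (x ! l))) (f1 v (x ! m)))
      = (map (effect v K x) \<circ> (\<lambda>(k, l, m). map (\<lambda>((a, b), c). lab K [(k, Suc a), (l, Suc b), (m, Suc c)])
         (List.product (List.product [0..<v-1] [0..<v-1]) [0..<v-1]))) z"
      by (auto simp: f1_lev kron_map effect_lab triples_lex_bounds split: prod.splits)
  qed
  show ?thesis unfolding fvec_def label_list_def map_append 1 2 3 ..
qed

lemma sum_lessThan_choose_2: "(\<Sum>k<n. k) = n choose 2"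
  by (induction n) (simp_all add: numeral_2_eq_2)

lemma length_pairs_lex: "length (pairs_lex K) = K choose 2"
proof -
  have "length (pairs_lex K) = (\<Sum>k<K. K - Suc k)"
    by (simp add: pairs_lex_def length_concat comp_def interv_sum_list_conv_sum_set_nat atLeast0LessThan)
  also have "\<dots> = (\<Sum>k<K. k)"
    by (rule sum.nat_diff_reindex)
  also have "\<dots> = K choose 2"
    by (rule sum_lessThan_choose_2)
  finally show ?thesis .
qed

text \<open>Reversing the index in both the inner and the outer sum turns the nested count into a
  hockey-stick sum of \<open>k choose 2\<close>.\<close>

lemma length_triples_lex: "length (triples_lex K) = K choose 3"
proof -
  have inner: "(\<Sum>l=Suc k..<K. K - Suc l) = (K - Suc k) choose 2" if "k < K" for k
  proof -
    have "(\<Sum>l=Suc k..<K. K - Suc l) = (\<Sum>i<K - Suc k. K - Suc k - Suc i)"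
      using that by (intro sum.reindex_bij_witness[of _ "\<lambda>i. i + Suc k" "\<lambda>l. l - Suc k"]) auto
    also have "\<dots> = (\<Sum>i<K - Suc k. i)" by (rule sum.nat_diff_reindex)
    also have "\<dots> = (K - Suc k) choose 2"
      by (rule sum_lessThan_choose_2)
    finally show ?thesis .
  qed
  have "length (triples_lex K) = (\<Sum>k<K. \<Sum>l=Suc k..<K. K - Suc l)"
    by (simp add: triples_lex_def length_concat comp_def interv_sum_list_conv_sum_set_nat atLeast0LessThan)
  also have "\<dots> = (\<Sum>k<K. (K - Suc k) choose 2)"
    by (rule sum.cong) (auto simp: inner)
  also have "\<dots> = (\<Sum>k<K. k choose 2)"
    by (rule sum.nat_diff_reindex)
  also have "\<dots> = K choose 3"
    by (induction K) (simp_all add: numeral_3_eq_3 numeral_2_eq_2)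
  finally show ?thesis .
qed

lemma length_label_list: "length (label_list v K) = pdim v K"
  by (simp add: label_list_def length_concat comp_def case_prod_unfold sum_list_triv
      length_pairs_lex length_triples_lex pdim_def power2_eq_square power3_eq_cube)

lemma eq_lab:
  assumes "u \<in> {..<K} \<rightarrow>\<^sub>E {..<v}" "supp K u = set ks"
  shows "u = lab K (map (\<lambda>k. (k, u k)) ks)"
proof
  fix k
  show "u k = lab K (map (\<lambda>k. (k, u k)) ks) k"
    using assms by (auto simp: lab_def map_of_map_restrict restrict_map_def supp_def set_eq_iff)
qed

lemma lab_in_label_list:
  shows "k < K \<Longrightarrow> a < v - 1 \<Longrightarrow> lab K [(k, Suc a)] \<in> set (label_list v K)"
    and "k < l \<Longrightarrow> l < K \<Longrightarrow> a < v - 1 \<Longrightarrow> b < v - 1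
      \<Longrightarrow> lab K [(k, Suc a), (l, Suc b)] \<in> set (label_list v K)"
    and "k < l \<Longrightarrow> l < m \<Longrightarrow> m < K \<Longrightarrow> a < v - 1 \<Longrightarrow> b < v - 1 \<Longrightarrow> c < v - 1
      \<Longrightarrow> lab K [(k, Suc a), (l, Suc b), (m, Suc c)] \<in> set (label_list v K)"
proof -
  assume "k < K" "a < v - 1"
  then show "lab K [(k, Suc a)] \<in> set (label_list v K)"
    unfolding label_list_def set_append set_concat set_map
    by (intro UnI1 UN_I[OF imageI[of k]]) simp_all
next
  assume "k < l" "l < K" "a < v - 1" "b < v - 1"
  then show "lab K [(k, Suc a), (l, Suc b)] \<in> set (label_list v K)"
    unfolding label_list_def set_append set_concat set_map
    by (intro UnI2 UnI1 UN_I[OF imageI[of "(k, l)"]])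
      (simp_all add: pairs_lex_bounds image_eqI[of _ _ "(a, b)"])
next
  assume "k < l" "l < m" "m < K" "a < v - 1" "b < v - 1" "c < v - 1"
  then show "lab K [(k, Suc a), (l, Suc b), (m, Suc c)] \<in> set (label_list v K)"
    unfolding label_list_def set_append set_concat set_map
    by (intro UnI2 UN_I[OF imageI[of "(k, l, m)"]])
      (simp_all add: triples_lex_bounds image_eqI[of _ _ "((a, b), c)"])
qed

text \<open>Sorting the support increasingly leads to an entry of the block that belongs to its
  size; the levels are recovered from the values of the label.\<close>

lemma labels_subset_label_list: "labels v K \<subseteq> set (label_list v K)"
proof
  fix u assume u: "u \<in> labels v K"
  then have uE: "u \<in> {..<K} \<rightarrow>\<^sub>E {..<v}" and cs: "card (supp K u) \<in> {1..3}" by (auto simp: labels_def)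
  have val: "\<exists>a < v - 1. u k = Suc a" if "k \<in> supp K u" for k
  proof -
    have "u k < v" "u k \<noteq> 0" using that uE by (auto simp: supp_def)
    then show ?thesis by (intro exI[of _ "u k - 1"]) auto
  qed
  have lt: "k < K" if "k \<in> supp K u" for k using that by (simp add: supp_def)
  consider "card (supp K u) = 1" | "card (supp K u) = 2" | "card (supp K u) = 3" using cs by force
  then show "u \<in> set (label_list v K)"
  proof cases
    case 1
    then obtain k where k: "supp K u = {k}" by (auto simp: card_1_singleton_iff)
    then obtain a where a: "a < v - 1" "u k = Suc a" using val[of k] by auto
    have "u = lab K [(k, Suc a)]" using eq_lab[OF uE, of "[k]"] k a by simp
    then show ?thesis using a lt[of k] k lab_in_label_list(1) by simp
  next
    case 2
    then obtain x y where xy: "supp K u = {x, y}" "x \<noteq> y" by (auto simp: card_2_iff)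
    \<comment> \<open>\<open>pairs_lex\<close> lists only pairs with k < l, so the two attributes
      are put in order first.\<close>
    define k l where "k = min x y" and "l = max x y"
    have kl: "supp K u = {k, l}" "k < l" using xy by (auto simp: k_def l_def min_def max_def)
    then obtain a b where ab: "a < v - 1" "u k = Suc a" "b < v - 1" "u l = Suc b"
      using val[of k] val[of l] by auto
    have "u = lab K [(k, Suc a), (l, Suc b)]" using eq_lab[OF uE, of "[k, l]"] kl ab by simp
    then show ?thesis using ab kl lt[of l] lab_in_label_list(2)[of k l K] by simp
  next
    case 3
    obtain ks where ks: "set ks = supp K u" "sorted ks" "distinct ks"
      using finite_distinct_list[OF finite_supp] finite_sorted_distinct_unique[OF finite_supp] by metis
    then have "length ks = 3" using 3 by (metis distinct_card)
    then obtain k l m where klm: "ks = [k, l, m]" by (auto simp: length_Suc_conv numeral_3_eq_3)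
    then have less: "k < l" "l < m" "m < K" using ks lt[of m] by auto
    obtain a b c where abc: "a < v - 1" "u k = Suc a" "b < v - 1" "u l = Suc b" "c < v - 1" "u m = Suc c"
      using val[of k] val[of l] val[of m] ks klm by auto
    have "u = lab K [(k, Suc a), (l, Suc b), (m, Suc c)]"
      using eq_lab[OF uE, of "[k, l, m]"] ks klm abc by simp
    then show ?thesis using abc less lab_in_label_list(3)[of k l m K] by simp
  qed
qed

text \<open>A counting argument: the list has length \<open>pdim v K\<close> and contains all
  labels, of which there are also \<open>pdim v K\<close>. So nothing is repeated and nothing else
  occurs.\<close>

lemma distinct_label_list:
  assumes "v \<ge> 1"
  shows "distinct (label_list v K)" and "set (label_list v K) = labels v K"
proof -
  have le: "card (labels v K) \<le> card (set (label_list v K))"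
    by (rule card_mono[OF _ labels_subset_label_list]) simp
  moreover have "card (set (label_list v K)) \<le> card (labels v K)"
    using card_length[of "label_list v K"] by (simp add: card_labels[OF assms] length_label_list)
  ultimately have eq: "card (labels v K) = card (set (label_list v K))" by simp
  then show "distinct (label_list v K)"
    by (intro card_distinct) (simp add: card_labels[OF assms] length_label_list)
  show "set (label_list v K) = labels v K"
    using card_subset_eq[OF _ labels_subset_label_list eq] by simp
qed

lemma bij_label_list:
  assumes "v \<ge> 1"
  shows "bij_betw (\<lambda>r. label_list v K ! r) {..<pdim v K} (labels v K)"
  using bij_betw_nth[OF distinct_label_list(1)[OF assms]] 
  by (simp add: length_label_list distinct_label_list(2)[OF assms])

lemma sum_label_list:
  assumes "v \<ge> 1"
  shows "(\<Sum>r<pdim v K. H (label_list v K ! r)) = (\<Sum>u\<in>labels v K. H u)"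
  using sum.reindex_bij_betw[OF bij_label_list[OF assms]] .

lemma gvec_label_list:
  assumes "r < pdim v K"
  shows "gvec v K x $ r = effect v K (fst x) (label_list v K ! r) - effect v K (snd x) (label_list v K ! r)"
  using assms by (simp add: gvec_def fvec_label_list length_label_list vec_of_list_index)

section \<open>Second moments of the uniform designs\<close>

text \<open>The matrix \<open>I + J\<close> on the indices \<open>1, \<dots>, v - 1\<close>, bordered by a \<open>1\<close> at index \<open>0\<close>.\<close>

definition gram :: "nat \<Rightarrow> nat \<Rightarrow> real" where
  "gram p q = (if p = 0 \<and> q = 0 then 1 else if p = 0 \<or> q = 0 then 0 else if p = q then 2 else 1)"

text \<open>
  For a random pair with active attributes \<open>A\<close> and differing attributes \<open>D\<close>, the mixed second moment
  of the two levels' effects at attribute \<open>k\<close> is \<open>rho v A D k\<close> times \<open>I + J\<close>. The second moment of a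
  single level is the special case in which \<open>D\<close> is empty.
\<close>

definition rho :: "nat \<Rightarrow> nat set \<Rightarrow> nat set \<Rightarrow> nat \<Rightarrow> real" where
  "rho v A D k = (if k \<in> D then - 1 / (real v * (real v - 1)) else if k \<in> A then 1 / real v else 0)"

text \<open>Once \<open>A\<close> and \<open>D\<close> are fixed, the choices at different
  attributes are independent: the pairs with this pattern are the product of these cells.\<close>

definition cells :: "nat \<Rightarrow> nat set \<Rightarrow> nat set \<Rightarrow> nat \<Rightarrow> (nat \<times> nat) set" where
  "cells v A D k = (if k \<in> D then {(a, b). a \<in> {1..v} \<and> b \<in> {1..v} \<and> a \<noteq> b}
     else if k \<in> A then (\<lambda>a. (a, a)) ` {1..v} else {(0, 0)})"

definition shapes :: "nat \<Rightarrow> nat \<Rightarrow> nat \<Rightarrow> (nat set \<times> nat set) set" where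
  "shapes K S d = {(A, D). D \<subseteq> A \<and> A \<subseteq> {..<K} \<and> card A = S \<and> card D = d}"

section \<open>Pairs of given comparison depth as a disjoint union of products of cells\<close>

lemma finite_offdiag: "finite {(a, b). a \<in> {1..v::nat} \<and> b \<in> {1..v} \<and> a \<noteq> b}"
  by (rule finite_subset[of _ "{1..v} \<times> {1..v}"]) auto

lemma finite_cells [simp]: "finite (cells v A D k)"
  using finite_offdiag by (simp add: cells_def)

lemma finite_shapes [simp]: "finite (shapes K S d)"
  unfolding shapes_def
  by (rule finite_subset[of _ "Pow {..<K} \<times> Pow {..<K}"]) auto

text \<open>The set \<open>A\<close> in the definition of \<open>region\<close> is forced to be the
  set of nonzero positions of \<open>i\<close>, so the existential quantifier turns into conditions
  on single attributes and two cardinalities.\<close>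

lemma region_d_iff:
  "(i, j) \<in> region_d v K S d \<longleftrightarrow> length i = K \<and> length j = K
     \<and> (\<forall>k<K. i ! k \<le> v \<and> j ! k \<le> v \<and> (i ! k = 0 \<longleftrightarrow> j ! k = 0))
     \<and> card {k. k < K \<and> i ! k \<noteq> 0} = S \<and> card {k. k < K \<and> i ! k \<noteq> j ! k} = d" (is "?L \<longleftrightarrow> ?R")
proof
  assume L: ?L
  then have len: "length i = K" "length j = K"
    and bd: "set i \<subseteq> {0..v}" "set j \<subseteq> {0..v}" and nd: "ndiff i j = d"
    by (auto simp: region_d_def region_def profiles_def)
  have bd': "i ! k \<le> v" "j ! k \<le> v" if "k < K" for k
    using that bd len by (metis atLeastAtMost_iff nth_mem subsetD)+
  obtain A where A: "A \<subseteq> {0..<K}" "card A = S"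
    "\<forall>k\<in>A. i ! k \<in> {1..v} \<and> j ! k \<in> {1..v}" "\<forall>k\<in>{0..<K} - A. i ! k = 0 \<and> j ! k = 0"
    using L by (auto simp: region_d_def region_def)
  have nz: "i ! k \<noteq> 0 \<longleftrightarrow> k \<in> A" "j ! k \<noteq> 0 \<longleftrightarrow> k \<in> A" if "k < K" for k
    using bspec[OF A(3), of k] bspec[OF A(4), of k] that by (cases "k \<in> A"; simp)+
  then have "{k. k < K \<and> i ! k \<noteq> 0} = A" using A(1) by auto
  moreover have "{k \<in> {0..<length i}. i ! k \<noteq> j ! k} = {k. k < K \<and> i ! k \<noteq> j ! k}" using len by auto
  ultimately show ?R using len bd' nz A(2) nd unfolding ndiff_def by metis
next
  assume R: ?R
  have "{k \<in> {0..<length i}. i ! k \<noteq> j ! k} = {k. k < K \<and> i ! k \<noteq> j ! k}" using R by auto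
  then have nd: "ndiff i j = d" using R by (simp add: ndiff_def)
  have prof: "i \<in> profiles v K" "j \<in> profiles v K"
    using R by (auto simp: profiles_def in_set_conv_nth)
  have "(i, j) \<in> region v K S"
    unfolding region_def using prof R
    by (auto intro!: exI[of _ "{k. k < K \<and> i ! k \<noteq> 0}"] simp: Suc_le_eq)
  then show ?L using nd by (simp add: region_d_def)
qed

text \<open>A pair determines its shape as the sets of its nonzero and of its differing positions,
  and any choice from the cells of a shape comes from exactly one pair. The maps \<open>?to\<close>
  and \<open>?of\<close> are the two directions of this bijection.\<close>

lemma sum_region_d:
  fixes H :: "nat list \<times> nat list \<Rightarrow> 'b::comm_monoid_add"
  shows "(\<Sum>x\<in>region_d v K S d. H x) = (\<Sum>(A, D)\<in>shapes K S d.
     \<Sum>z\<in>PiE {..<K} (cells v A D). H (map (\<lambda>k. fst (z k)) [0..<K], map (\<lambda>k. snd (z k)) [0..<K]))"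
proof -
  let ?S = "Sigma (shapes K S d) (\<lambda>(A, D). PiE {..<K} (cells v A D))"
  let ?to = "\<lambda>x. (({k. k < K \<and> fst x ! k \<noteq> 0}, {k. k < K \<and> fst x ! k \<noteq> snd x ! k}),
      \<lambda>k\<in>{..<K}. (fst x ! k :: nat, snd x ! k :: nat))"
  let ?of = "\<lambda>(AD :: nat set \<times> nat set, z). (map (\<lambda>k. fst (z k) :: nat) [0..<K], map (\<lambda>k. snd (z k) :: nat) [0..<K])"
  have "(\<Sum>x\<in>region_d v K S d. H x) = (\<Sum>y\<in>?S. H (?of y))"
  proof (rule sum.reindex_bij_witness[where i = ?of and j = ?to])
    fix x assume "x \<in> region_d v K S d"
    then have x: "(fst x, snd x) \<in> region_d v K S d" by simp
    note R = x[unfolded region_d_iff]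
    have "map (\<lambda>k. fst ((\<lambda>k\<in>{..<K}. (fst x ! k, snd x ! k)) k)) [0..<K] = fst x"
         "map (\<lambda>k. snd ((\<lambda>k\<in>{..<K}. (fst x ! k, snd x ! k)) k)) [0..<K] = snd x"
      using R by (auto intro!: nth_equalityI)
    then show ofto: "?of (?to x) = x" by simp
    then show "H (?of (?to x)) = H x" by simp
    show "?to x \<in> ?S"
      using R by (auto simp: shapes_def cells_def Suc_le_eq)
  next
    fix y assume y: "y \<in> ?S"
    obtain A D z where yeq: "y = ((A, D), z)" by (metis prod.exhaust)
    have sh: "D \<subseteq> A" "A \<subseteq> {..<K}" "card A = S" "card D = d" and z: "z \<in> PiE {..<K} (cells v A D)"
      using y by (auto simp: yeq shapes_def)
    have zk: "z k \<in> cells v A D k" if "k < K" for k using PiE_mem[OF z, of k] that by simp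
    have c: "fst (z k) \<le> v" "snd (z k) \<le> v" "fst (z k) = 0 \<longleftrightarrow> snd (z k) = 0"
      "fst (z k) \<noteq> 0 \<longleftrightarrow> k \<in> A" "fst (z k) \<noteq> snd (z k) \<longleftrightarrow> k \<in> D" if "k < K" for k
      using zk[OF that] sh(1) by (auto simp: cells_def split: if_splits)
    have A: "{k. k < K \<and> map (\<lambda>k. fst (z k)) [0..<K] ! k \<noteq> 0} = A"
      using c(4) sh by auto
    have D: "{k. k < K \<and> map (\<lambda>k. fst (z k)) [0..<K] ! k \<noteq> map (\<lambda>k. snd (z k)) [0..<K] ! k} = D"
    proof -
      have "{k. k < K \<and> map (\<lambda>k. fst (z k)) [0..<K] ! k \<noteq> map (\<lambda>k. snd (z k)) [0..<K] ! k}
          = {k. k < K \<and> fst (z k) \<noteq> snd (z k)}" by (rule Collect_cong) auto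
      also have "\<dots> = D" using c(5) subset_trans[OF sh(1,2)] by auto
      finally show ?thesis .
    qed
    have "(\<lambda>k\<in>{..<K}. (map (\<lambda>k. fst (z k)) [0..<K] ! k, map (\<lambda>k. snd (z k)) [0..<K] ! k)) = z"
      by (rule ext) (simp add: restrict_def PiE_arb[OF z])
    then show "?to (?of y) = y" using A D by (simp add: yeq)
    show "?of y \<in> region_d v K S d"
      unfolding yeq case_prod_conv region_d_iff A D using c(1-3) sh(3,4) by simp
  qed
  also have "\<dots> = (\<Sum>AD\<in>shapes K S d. \<Sum>z\<in>(case AD of (A, D) \<Rightarrow> PiE {..<K} (cells v A D)). H (?of (AD, z)))"
    by (subst sum.Sigma) (auto intro!: finite_PiE simp: case_prod_unfold)
  also have "\<dots> = (\<Sum>(A, D)\<in>shapes K S d.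
     \<Sum>z\<in>PiE {..<K} (cells v A D). H (map (\<lambda>k. fst (z k)) [0..<K], map (\<lambda>k. snd (z k)) [0..<K]))"
    by (rule sum.cong) auto
  finally show ?thesis .
qed

lemma sum_region_d_prod:
  fixes \<psi> :: "nat \<Rightarrow> nat \<Rightarrow> nat \<Rightarrow> 'b::comm_semiring_1"
  shows "(\<Sum>x\<in>region_d v K S d. \<Prod>k<K. \<psi> k (fst x ! k) (snd x ! k))
     = (\<Sum>(A, D)\<in>shapes K S d. \<Prod>k<K. \<Sum>(a, b)\<in>cells v A D k. \<psi> k a b)"
  unfolding sum_region_d
proof (intro sum.cong refl, clarify)
  fix A D
  have "(\<Sum>z\<in>PiE {..<K} (cells v A D). \<Prod>k<K. \<psi> k (fst (z k)) (snd (z k)))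
     = (\<Prod>k<K. \<Sum>ab\<in>cells v A D k. \<psi> k (fst ab) (snd ab))"
    by (rule prod_sum_PiE[symmetric]) auto
  then show "(\<Sum>z\<in>PiE {..<K} (cells v A D). \<Prod>k<K. \<psi> k
        (fst (map (\<lambda>k. fst (z k)) [0..<K], map (\<lambda>k. snd (z k)) [0..<K]) ! k)
        (snd (map (\<lambda>k. fst (z k)) [0..<K], map (\<lambda>k. snd (z k)) [0..<K]) ! k))
     = (\<Prod>k<K. \<Sum>(a, b)\<in>cells v A D k. \<psi> k a b)"
    by (simp add: case_prod_unfold)
qed

section \<open>Moments of a single attribute\<close>

lemma sum_lev_lev:
  assumes "v \<ge> 1" "p < v" "q < v"
  shows "(\<Sum>a=1..v. lev v a p * lev v a q) = (if p = 0 then real v else 1) * gram p q"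
proof -
  have "{1..v} = insert v {1..<v}" using assms by auto
  \<comment> \<open>For p, q > 0 level \<open>v\<close> contributes (-1)(-1) = 1, an entry of J, and
    the levels below \<open>v\<close> contribute the entry of I. If just one index is 0, the two
    parts are -1 and 1 and cancel; if both are 0, the sum counts the levels.\<close>
  then have "(\<Sum>a=1..v. lev v a p * lev v a q) = lev v v p * lev v v q + (\<Sum>a\<in>{1..<v}. lev v a p * lev v a q)"
    by simp
  also have "(\<Sum>a\<in>{1..<v}. lev v a p * lev v a q)
      = (\<Sum>a\<in>{1..<v}. if p = 0 then (if q = 0 then 1 else if a = q then 1 else 0)
          else if q = 0 then (if a = p then 1 else 0) else if a = p then (if p = q then 1 else 0) else 0)"
    by (rule sum.cong) (auto simp: lev_def)
  also have "lev v v p * lev v v q + \<dots> = (if p = 0 then real v else 1) * gram p q"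
    using assms by (auto simp: lev_def gram_def of_nat_diff)
  finally show ?thesis .
qed

lemma sum_lev:
  assumes "v \<ge> 1" "p < v"
  shows "(\<Sum>a=1..v. lev v a p) = (if p = 0 then real v else 0)"
  using sum_lev_lev[OF assms, of 0] assms(1) by (auto simp: lev_def gram_def split: if_splits)

text \<open>The full square minus its diagonal. At a differing attribute the levels sum to zero, so
  only the diagonal term survives; hence the negative value of \<open>rho\<close> on
  \<open>D\<close>.\<close>

lemma sum_offdiag:
  fixes f g :: "nat \<Rightarrow> real"
  shows "(\<Sum>(a, b) | a \<in> {1..v} \<and> b \<in> {1..v} \<and> a \<noteq> b. f a * g b)
     = sum f {1..v} * sum g {1..v} - (\<Sum>a=1..v. f a * g a)"
proof -
  let ?d = "(\<lambda>a. (a, a)) ` {1..v}"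
  have eq: "{(a, b). a \<in> {1..v} \<and> b \<in> {1..v} \<and> a \<noteq> b} = {1..v} \<times> {1..v} - ?d" by auto
  have "(\<Sum>(a, b)\<in>{1..v} \<times> {1..v} - ?d. f a * g b)
      = (\<Sum>(a, b)\<in>{1..v} \<times> {1..v}. f a * g b) - (\<Sum>(a, b)\<in>?d. f a * g b)"
    by (rule sum_diff) auto
  also have "(\<Sum>(a, b)\<in>?d. f a * g b) = (\<Sum>a=1..v. f a * g a)"
    by (subst sum.reindex) (auto simp: inj_on_def)
  also have "(\<Sum>(a, b)\<in>{1..v} \<times> {1..v}. f a * g b) = sum f {1..v} * sum g {1..v}"
    by (simp add: sum_product sum.cartesian_product)
  finally show ?thesis unfolding eq .
qed

definition cell_size :: "nat \<Rightarrow> nat set \<Rightarrow> nat set \<Rightarrow> nat \<Rightarrow> real" where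
  "cell_size v A D k = (if k \<in> D then real v * (real v - 1) else if k \<in> A then real v else 1)"

lemma sum_cells:
  fixes f g :: "nat \<Rightarrow> real"
  shows "(\<Sum>(a, b)\<in>cells v A D k. f a * g b) =
    (if k \<in> D then sum f {1..v} * sum g {1..v} - (\<Sum>a=1..v. f a * g a)
     else if k \<in> A then (\<Sum>a=1..v. f a * g a) else f 0 * g 0)"
proof -
  have "(\<Sum>(a, b)\<in>(\<lambda>a. (a, a)) ` {1..v}. f a * g b) = (\<Sum>a=1..v. f a * g a)"
    by (subst sum.reindex) (auto simp: inj_on_def)
  then show ?thesis using sum_offdiag[of f g v] by (simp add: cells_def)
qed

text \<open>A moment of one level alone does not see whether the other level differs, hence
  \<open>rho v A {}\<close> in the first two claims. Index 0 carries no effect, so p = q = 0 gives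
  just the cell size, and if one index alone is 0 both sides vanish.\<close>

lemma cell_moments:
  assumes v: "v \<ge> 2" and p: "p < v" and q: "q < v" and DA: "D \<subseteq> A"
  shows cell_moment_fst: "(\<Sum>(a, b)\<in>cells v A D k. lev v a p * lev v a q)
      = cell_size v A D k * (if p = 0 then 1 else rho v A {} k) * gram p q"
    and cell_moment_snd: "(\<Sum>(a, b)\<in>cells v A D k. lev v b p * lev v b q)
      = cell_size v A D k * (if p = 0 then 1 else rho v A {} k) * gram p q"
    and cell_moment_mixed: "(\<Sum>(a, b)\<in>cells v A D k. lev v a p * lev v b q)
      = cell_size v A D k * (if p = 0 then 1 else rho v A D k) * gram p q"
    and cell_moment_mixed': "(\<Sum>(a, b)\<in>cells v A D k. lev v b p * lev v a q)
      = cell_size v A D k * (if p = 0 then 1 else rho v A D k) * gram p q"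
proof -
  have v1: "v \<ge> 1" using v by simp
  have rv: "real v \<noteq> 0" "real v - 1 \<noteq> 0" using v by auto
  note L = sum_lev_lev[OF v1 p q] and L1 = sum_lev[OF v1 p] and L2 = sum_lev[OF v1 q]
  have lev0: "lev v 0 p * lev v 0 q = (if p = 0 then 1 else 0) * gram p q"
    using v by (auto simp: lev_def gram_def)
  \<comment> \<open>The trailing factor 1 gives the moment the shape \<open>f a * g b\<close>
    required by \<open>sum_cells\<close>.\<close>
  have fst': "(\<Sum>(a, b)\<in>cells v A D k. lev v a p * lev v a q * 1)
      = cell_size v A D k * (if p = 0 then 1 else rho v A {} k) * gram p q"
    unfolding sum_cells[of "\<lambda>a. lev v a p * lev v a q" "\<lambda>b. 1"]
    unfolding mult_1_left mult_1_right L lev0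
    using DA rv by (auto simp: rho_def cell_size_def algebra_simps)
  then show "(\<Sum>(a, b)\<in>cells v A D k. lev v a p * lev v a q)
      = cell_size v A D k * (if p = 0 then 1 else rho v A {} k) * gram p q" by simp
  have "(\<Sum>(a, b)\<in>cells v A D k. 1 * (lev v b p * lev v b q))
      = cell_size v A D k * (if p = 0 then 1 else rho v A {} k) * gram p q"
    unfolding sum_cells[of "\<lambda>b. 1" "\<lambda>a. lev v a p * lev v a q"]
    unfolding mult_1_left mult_1_right L lev0
    using DA rv by (auto simp: rho_def cell_size_def algebra_simps)
  then show "(\<Sum>(a, b)\<in>cells v A D k. lev v b p * lev v b q)
      = cell_size v A D k * (if p = 0 then 1 else rho v A {} k) * gram p q" by simp
  show mixed: "(\<Sum>(a, b)\<in>cells v A D k. lev v a p * lev v b q)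
      = cell_size v A D k * (if p = 0 then 1 else rho v A D k) * gram p q"
    unfolding sum_cells L L1 L2 lev0
    using DA rv by (auto simp: rho_def cell_size_def gram_def; simp add: algebra_simps)
  have "(\<Sum>(a, b)\<in>cells v A D k. lev v b p * lev v a q) = (\<Sum>(a, b)\<in>cells v A D k. lev v a q * lev v b p)"
    by (simp add: mult.commute)
  also have "\<dots> = (\<Sum>(a, b)\<in>cells v A D k. lev v a p * lev v b q)"
    unfolding sum_cells by (simp add: mult.commute)
  finally show "(\<Sum>(a, b)\<in>cells v A D k. lev v b p * lev v a q)
      = cell_size v A D k * (if p = 0 then 1 else rho v A D k) * gram p q" unfolding mixed .
qed

lemma prod_cell_size:
  assumes "(A, D) \<in> shapes K S d"
  shows "(\<Prod>k<K. cell_size v A D k) = real v ^ S * (real v - 1) ^ d"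
proof -
  have sh: "D \<subseteq> A" "A \<subseteq> {..<K}" "card A = S" "card D = d" using assms by (auto simp: shapes_def)
  have "(\<Prod>k<K. cell_size v A D k)
      = (\<Prod>k<K. (if k \<in> A then real v else 1) * (if k \<in> D then real v - 1 else 1))"
    using sh(1) by (intro prod.cong) (auto simp: cell_size_def)
  also have "\<dots> = (\<Prod>k\<in>A. real v) * (\<Prod>k\<in>D. real v - 1)"
    using sh prod_restrict_support[of A K "\<lambda>_. real v"] prod_restrict_support[of D K "\<lambda>_. real v - 1"]
    by (simp add: prod.distrib)
  finally show ?thesis using sh by simp
qed

text \<open>The cardinality is a moment of order zero: with index 0 at every attribute all factors
  \<open>lev\<close> are 1, so the factorisation over cells applies.\<close>

lemma card_region_d:
  assumes "v \<ge> 2"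
  shows "real (card (region_d v K S d)) = real (card (shapes K S d)) * (real v ^ S * (real v - 1) ^ d)"
proof -
  have "real (card (region_d v K S d)) = (\<Sum>x\<in>region_d v K S d. \<Prod>k<K. lev v (fst x ! k) 0 * lev v (snd x ! k) 0)"
    by (simp add: lev_def)
  also have "\<dots> = (\<Sum>(A, D)\<in>shapes K S d. \<Prod>k<K. \<Sum>(a, b)\<in>cells v A D k. lev v a 0 * lev v b 0)"
    by (rule sum_region_d_prod)
  also have "\<dots> = (\<Sum>AD\<in>shapes K S d. real v ^ S * (real v - 1) ^ d)"
  proof (intro sum.cong refl, clarify)
    fix A D assume AD: "(A, D) \<in> shapes K S d"
    then have "D \<subseteq> A" by (simp add: shapes_def)
    then have "(\<Sum>(a, b)\<in>cells v A D k. lev v a 0 * lev v b 0) = cell_size v A D k" for k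
      using cell_moment_mixed[of v 0 0 D A k] assms by (simp add: gram_def)
    then show "(\<Prod>k<K. \<Sum>(a, b)\<in>cells v A D k. lev v a 0 * lev v b 0) = real v ^ S * (real v - 1) ^ d"
      using prod_cell_size[OF AD] by simp
  qed
  finally show ?thesis by simp
qed

text \<open>Up to a factor 2 and the common cell size, the part of the second moment of f(i) - f(j)
  that is governed by the support: one-level moments minus mixed moments.\<close>

definition contrast :: "nat \<Rightarrow> nat \<Rightarrow> nat \<Rightarrow> nat \<Rightarrow> nat set \<Rightarrow> real" where
  "contrast v K S d T = (\<Sum>(A, D)\<in>shapes K S d. (\<Prod>k\<in>T. rho v A {} k) - (\<Prod>k\<in>T. rho v A D k))"

text \<open>The selectors \<chi> and \<chi>' stand for \<open>fst\<close> or \<open>snd\<close>, so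
  one factorisation serves all four products in the expansion of the outer product of f(i) - f(j)
  with itself.\<close>

lemma sum_effect_products:
  fixes M :: "nat set \<Rightarrow> nat set \<Rightarrow> nat \<Rightarrow> real" and \<chi> \<chi>' :: "nat \<times> nat \<Rightarrow> nat"
  assumes cell: "\<And>A D k. D \<subseteq> A \<Longrightarrow> k < K \<Longrightarrow> (\<Sum>(a, b)\<in>cells v A D k. lev v (\<chi> (a, b)) (u k) * lev v (\<chi>' (a, b)) (u' k))
      = cell_size v A D k * (if u k = 0 then 1 else M A D k) * gram (u k) (u' k)"
  shows "(\<Sum>x\<in>region_d v K S d. (\<Prod>k<K. lev v (\<chi> (fst x ! k, snd x ! k)) (u k))
        * (\<Prod>k<K. lev v (\<chi>' (fst x ! k, snd x ! k)) (u' k)))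
     = real v ^ S * (real v - 1) ^ d * (\<Sum>(A, D)\<in>shapes K S d. \<Prod>k\<in>supp K u. M A D k)
        * (\<Prod>k<K. gram (u k) (u' k))"
proof -
  have "(\<Sum>x\<in>region_d v K S d. (\<Prod>k<K. lev v (\<chi> (fst x ! k, snd x ! k)) (u k))
        * (\<Prod>k<K. lev v (\<chi>' (fst x ! k, snd x ! k)) (u' k)))
      = (\<Sum>(A, D)\<in>shapes K S d. \<Prod>k<K. \<Sum>(a, b)\<in>cells v A D k. lev v (\<chi> (a, b)) (u k) * lev v (\<chi>' (a, b)) (u' k))"
    unfolding prod.distrib[symmetric]
    by (rule sum_region_d_prod[where \<psi> = "\<lambda>k a b. lev v (\<chi> (a, b)) (u k) * lev v (\<chi>' (a, b)) (u' k)"])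
  also have "\<dots> = (\<Sum>(A, D)\<in>shapes K S d. real v ^ S * (real v - 1) ^ d * (\<Prod>k\<in>supp K u. M A D k)
        * (\<Prod>k<K. gram (u k) (u' k)))"
  proof (intro sum.cong refl, clarify)
    fix A D assume AD: "(A, D) \<in> shapes K S d"
    then have DA: "D \<subseteq> A" by (simp add: shapes_def)
    have "(\<Prod>k<K. \<Sum>(a, b)\<in>cells v A D k. lev v (\<chi> (a, b)) (u k) * lev v (\<chi>' (a, b)) (u' k))
       = (\<Prod>k<K. cell_size v A D k * (if k \<in> supp K u then M A D k else 1) * gram (u k) (u' k))"
    proof (rule prod.cong[OF refl])
      fix k assume "k \<in> {..<K}"
      then have "k < K" by simp
      then show "(\<Sum>(a, b)\<in>cells v A D k. lev v (\<chi> (a, b)) (u k) * lev v (\<chi>' (a, b)) (u' k))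
         = cell_size v A D k * (if k \<in> supp K u then M A D k else 1) * gram (u k) (u' k)"
        unfolding cell[OF DA \<open>k < K\<close>] by (simp add: supp_def)
    qed
    also have "\<dots> = real v ^ S * (real v - 1) ^ d * (\<Prod>k\<in>supp K u. M A D k) * (\<Prod>k<K. gram (u k) (u' k))"
      by (simp add: prod.distrib prod_cell_size[OF AD] prod_restrict_support[OF supp_subset])
    finally show "(\<Prod>k<K. \<Sum>(a, b)\<in>cells v A D k. lev v (\<chi> (a, b)) (u k) * lev v (\<chi>' (a, b)) (u' k))
       = real v ^ S * (real v - 1) ^ d * (\<Prod>k\<in>supp K u. M A D k) * (\<Prod>k<K. gram (u k) (u' k))" .
  qed
  finally show ?thesis by (simp add: sum_distrib_left sum_distrib_right case_prod_unfold)
qed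

lemma sum_region_d_gg:
  assumes v: "v \<ge> 2" and u: "\<And>k. k < K \<Longrightarrow> u k < v" "\<And>k. k < K \<Longrightarrow> u' k < v"
  shows "(\<Sum>x\<in>region_d v K S d. (effect v K (fst x) u - effect v K (snd x) u)
        * (effect v K (fst x) u' - effect v K (snd x) u'))
     = real v ^ S * (real v - 1) ^ d * (2 * contrast v K S d (supp K u)) * (\<Prod>k<K. gram (u k) (u' k))"
proof -
  let ?c = "real v ^ S * (real v - 1) ^ d" and ?g = "\<Prod>k<K. gram (u k) (u' k)"
  let ?P = "\<lambda>A D. \<Prod>k\<in>supp K u. rho v A D k"
  have ff: "(\<Sum>x\<in>region_d v K S d. effect v K (fst x) u * effect v K (fst x) u')
      = ?c * (\<Sum>(A, D)\<in>shapes K S d. ?P A {}) * ?g"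
    using sum_effect_products[of K v fst u fst u' "\<lambda>A D k. rho v A {} k" S d] cell_moment_fst[OF v] u
    by (simp add: effect_def)
  have ss: "(\<Sum>x\<in>region_d v K S d. effect v K (snd x) u * effect v K (snd x) u')
      = ?c * (\<Sum>(A, D)\<in>shapes K S d. ?P A {}) * ?g"
    using sum_effect_products[of K v snd u snd u' "\<lambda>A D k. rho v A {} k" S d] cell_moment_snd[OF v] u
    by (simp add: effect_def)
  have fs: "(\<Sum>x\<in>region_d v K S d. effect v K (fst x) u * effect v K (snd x) u')
      = ?c * (\<Sum>(A, D)\<in>shapes K S d. ?P A D) * ?g"
    using sum_effect_products[of K v fst u snd u' "\<lambda>A D k. rho v A D k" S d] cell_moment_mixed[OF v] u
    by (simp add: effect_def)
  have sf: "(\<Sum>x\<in>region_d v K S d. effect v K (snd x) u * effect v K (fst x) u')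
      = ?c * (\<Sum>(A, D)\<in>shapes K S d. ?P A D) * ?g"
    using sum_effect_products[of K v snd u fst u' "\<lambda>A D k. rho v A D k" S d] cell_moment_mixed'[OF v] u
    by (simp add: effect_def)
  have con: "contrast v K S d (supp K u) = (\<Sum>(A, D)\<in>shapes K S d. ?P A {}) - (\<Sum>(A, D)\<in>shapes K S d. ?P A D)"
    unfolding contrast_def by (simp add: case_prod_unfold sum_subtractf)
  have "(\<Sum>x\<in>region_d v K S d. (effect v K (fst x) u - effect v K (snd x) u)
        * (effect v K (fst x) u' - effect v K (snd x) u'))
     = (\<Sum>x\<in>region_d v K S d. effect v K (fst x) u * effect v K (fst x) u')
       - (\<Sum>x\<in>region_d v K S d. effect v K (fst x) u * effect v K (snd x) u')
       - (\<Sum>x\<in>region_d v K S d. effect v K (snd x) u * effect v K (fst x) u')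
       + (\<Sum>x\<in>region_d v K S d. effect v K (snd x) u * effect v K (snd x) u')"
    unfolding sum_subtractf[symmetric] sum.distrib[symmetric] by (rule sum.cong) (auto simp: algebra_simps)
  then show ?thesis unfolding ff ss fs sf con by (simp add: algebra_simps)
qed

section \<open>Symmetric polynomials of \<open>rho\<close> and the functions h_r\<close>

definition hr :: "nat \<Rightarrow> nat \<Rightarrow> nat \<Rightarrow> nat \<Rightarrow> nat \<Rightarrow> real" where
  "hr r = (if r = 1 then h1 else if r = 2 then h2 else h3)"

lemma real_choose_2: "real (K choose 2) = real K * (real K - 1) / 2"
  by (simp add: binomial_gbinomial gbinomial_prod_rev numeral_2_eq_2)

lemma real_choose_3: "real (K choose 3) = real K * (real K - 1) * (real K - 2) / 6"
  by (simp add: binomial_gbinomial gbinomial_prod_rev numeral_3_eq_3)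

lemma choose_2_h2:
  assumes "K \<ge> 2"
  shows "real (K choose 2) * h2 v K S d
     = real d * (2 * real S * real v - 2 * real S - real d * real v - real v + 2) / (4 * real v)"
  using assms by (simp add: real_choose_2 h2_def)

lemma choose_3_h3:
  assumes "K \<ge> 3"
  shows "real (K choose 3) * h3 v K S d = real d * lam v S d / (24 * (real v)\<^sup>2)"
  using assms by (simp add: real_choose_3 h3_def)

text \<open>\<open>rho\<close> has one value on the S - d attributes of A - D, another on the
  \<open>d\<close> attributes of \<open>D\<close>, and is 0 elsewhere; \<open>j > 0\<close> makes
  the zeros drop out of the power sum.\<close>

lemma sum_rho_power:
  assumes "(A, D) \<in> shapes K S d" "j > 0"
  shows "(\<Sum>k<K. rho v A D k ^ j)
     = (real S - real d) * (1 / real v) ^ j + real d * (- 1 / (real v * (real v - 1))) ^ j"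
proof -
  have sh: "D \<subseteq> A" "A \<subseteq> {..<K}" "card A = S" "card D = d" using assms by (auto simp: shapes_def)
  have fin: "finite A" "finite D" using sh by (auto intro: finite_subset)
  have "(\<Sum>k<K. rho v A D k ^ j) = (\<Sum>k\<in>A. rho v A D k ^ j)"
    using sh assms(2) by (intro sum.mono_neutral_right) (auto simp: rho_def)
  also have "\<dots> = (\<Sum>k\<in>A - D. rho v A D k ^ j) + (\<Sum>k\<in>D. rho v A D k ^ j)"
    using sum.subset_diff[OF sh(1) fin(1)] .
  also have "(\<Sum>k\<in>A - D. rho v A D k ^ j) = real (card (A - D)) * (1 / real v) ^ j"
    by (simp add: rho_def)
  also have "(\<Sum>k\<in>D. rho v A D k ^ j) = real d * (- 1 / (real v * (real v - 1))) ^ j"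
    using sh by (simp add: rho_def)
  also have "real (card (A - D)) = real S - real d"
    using sh fin card_mono[OF fin(1) sh(1)] by (simp add: card_Diff_subset of_nat_diff)
  finally show ?thesis .
qed

text \<open>The source of the polynomials in \<open>h2\<close> and \<open>h3\<close>. By Newton's
  identities both terms are expressed in power sums and brought to the denominator (V n)^r, where n
  = v - 1; substituting V = n + 1, the numerator is d v times 1, the bracket of \<open>h2\<close> or
  \<open>lam\<close>. The result depends on the shape only through \<open>S\<close> and
  \<open>d\<close>.\<close>

lemma esym_contrast:
  assumes v: "v \<ge> 2" and K: "K \<ge> 3" and AD: "(A, D) \<in> shapes K S d" and r: "r \<in> {1..3}"
  shows "2 * (esym {..<K} (rho v A {}) r - esym {..<K} (rho v A D) r)
     = real (K choose r) * (2 / (real v - 1)) ^ r * hr r v K S d"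
proof -
  define n V s e where "n = real v - 1" and "V = real v" and "s = real S" and "e = real d"
  have nz: "n \<noteq> 0" "V \<noteq> 0" and Vn: "V = n + 1" using v by (auto simp: n_def V_def)
  have n_V: "V - 1 = n" by (simp add: Vn)
  have kz: "real K \<noteq> 0" "real K - 1 \<noteq> 0" "real K - 2 \<noteq> 0" using K by auto
  have AE: "(A, {}) \<in> shapes K S 0" using AD by (auto simp: shapes_def)
  have p0: "(\<Sum>k<K. rho v A {} k ^ j) = s / V ^ j" if "j > 0" for j
    using sum_rho_power[OF AE that, of v] by (simp add: s_def V_def power_divide)
  have p: "(\<Sum>k<K. rho v A D k ^ j) = ((s - e) * n ^ j + e * (-1) ^ j) / (V * n) ^ j" if "j > 0" for j
  proof -
    have "(1 / V) ^ j = n ^ j / (V * n) ^ j" using nz by (simp add: power_divide power_mult_distrib)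
    then show ?thesis using sum_rho_power[OF AD that, of v]
      by (simp add: s_def[symmetric] e_def[symmetric] n_def[symmetric] V_def[symmetric] n_V
          power_divide[of "- 1"] add_divide_distrib del: divide_minus_left)
  qed
  note q = p0[of 1, simplified] p0[of 2, simplified] p0[of 3, simplified]
    p[of 1, simplified] p[of 2, simplified] p[of 3, simplified]
  consider "r = 1" | "r = 2" | "r = 3" using r by force
  then show ?thesis
  proof cases
    case 1
    have "esym {..<K} (rho v A {}) 1 - esym {..<K} (rho v A D) 1 = s / V - ((s - e) * n - e) / (V * n)"
      by (simp add: esym_1 q del: One_nat_def)
    also have "\<dots> = (s * n - ((s - e) * n - e)) / (V * n)"
      using nz by (simp add: diff_divide_distrib)
    also have "s * n - ((s - e) * n - e) = e * V"
      by (simp add: Vn algebra_simps)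
    also have "e * V / (V * n) = e / n" using nz by simp
    finally show ?thesis using 1 kz by (simp add: hr_def h1_def e_def n_def)
  next
    case 2
    define x1 x2 where "x1 = (s - e) * n - e" and "x2 = (s - e) * n ^ 2 + e"
    have "2 * (esym {..<K} (rho v A {}) 2 - esym {..<K} (rho v A D) 2)
        = ((s / V)\<^sup>2 - s / V\<^sup>2) - ((x1 / (V * n))\<^sup>2 - x2 / (V * n)\<^sup>2)"
      by (simp add: right_diff_distrib esym_2 q x1_def x2_def)
    also have "\<dots> = ((s\<^sup>2 - s) * n\<^sup>2 - (x1\<^sup>2 - x2)) / (V * n)\<^sup>2"
      using nz by (simp add: field_simps)
    also have "(s\<^sup>2 - s) * n\<^sup>2 - (x1\<^sup>2 - x2) = e * V * (2 * s * V - 2 * s - e * V - V + 2)"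
      unfolding x1_def x2_def Vn by (simp add: power2_eq_square algebra_simps)
    finally have eq: "2 * (esym {..<K} (rho v A {}) 2 - esym {..<K} (rho v A D) 2)
        = e * V * (2 * s * V - 2 * s - e * V - V + 2) / (V * n)\<^sup>2" .
    \<comment> \<open>Splitting off (2 / n)^2 leaves \<open>K choose 2\<close> times
      \<open>h2\<close>.\<close>
    have "e * V * B / (V * n)\<^sup>2 = (e * B / (4 * V)) * (2 / n)\<^sup>2" for B
      using nz by (simp add: power2_eq_square)
    then have "e * V * (2 * s * V - 2 * s - e * V - V + 2) / (V * n)\<^sup>2
        = (e * (2 * s * V - 2 * s - e * V - V + 2) / (4 * V)) * (2 / n)\<^sup>2" .
    also have "e * (2 * s * V - 2 * s - e * V - V + 2) / (4 * V) = real (K choose 2) * h2 v K S d"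
      using K unfolding e_def V_def s_def by (intro choose_2_h2[symmetric]) simp
    finally show ?thesis using eq unfolding 2 hr_def by (simp add: n_def mult_ac)
  next
    case 3
    define x1 x2 x3 where "x1 = (s - e) * n - e" and "x2 = (s - e) * n ^ 2 + e" and "x3 = (s - e) * n ^ 3 - e"
    define L where "L = lam v S d"
    have L: "L = 3*s^2 + 3*s^2*V^2 - 6*s^2*V - 3*s*e*V^2 + 3*s*e*V - 6*s*V^2 + 15*s*V - 9*s
     + e^2*V^2 + 3*e*V^2 - 6*e*V + 2*V^2 - 6*V + 6"
      by (simp add: L_def lam_def s_def V_def e_def Let_def)
    have newton: "(a / W) ^ 3 - 3 * (a / W) * (b / W\<^sup>2) + 2 * (c / W ^ 3) = (a ^ 3 - 3 * a * b + 2 * c) / W ^ 3"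
      for a b c W :: real
      by (simp add: power_divide power2_eq_square power3_eq_cube add_divide_distrib diff_divide_distrib)
    have "6 * (esym {..<K} (rho v A {}) 3 - esym {..<K} (rho v A D) 3)
        = ((s / V)^3 - 3 * (s / V) * (s / V\<^sup>2) + 2 * (s / V ^ 3))
          - ((x1 / (V * n))^3 - 3 * (x1 / (V * n)) * (x2 / (V * n)\<^sup>2) + 2 * (x3 / (V * n) ^ 3))"
      unfolding right_diff_distrib[of 6] esym_3[OF finite_lessThan] q x1_def x2_def x3_def ..
    also have "\<dots> = ((s ^ 3 - 3 * s * s + 2 * s) / V ^ 3) - ((x1 ^ 3 - 3 * x1 * x2 + 2 * x3) / (V * n) ^ 3)"
      by (simp only: newton)
    also have "\<dots> = ((s ^ 3 - 3 * s * s + 2 * s) * n ^ 3 - (x1 ^ 3 - 3 * x1 * x2 + 2 * x3)) / (V * n) ^ 3"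
      using nz by (simp add: diff_divide_distrib power_mult_distrib)
    also have "(s ^ 3 - 3 * s * s + 2 * s) * n ^ 3 - (x1 ^ 3 - 3 * x1 * x2 + 2 * x3) = e * V * L"
      unfolding x1_def x2_def x3_def Vn L by (simp add: power2_eq_square power3_eq_cube algebra_simps)
    finally have eq: "6 * (esym {..<K} (rho v A {}) 3 - esym {..<K} (rho v A D) 3) = e * V * L / (V * n) ^ 3" .
    \<comment> \<open>Newton's identity gives 6 times the polynomial and the claim concerns 2 times
      it, hence the 3; the constant is 24 = 3 * 2^3.\<close>
    have "e * V * L / (V * n) ^ 3 = 3 * ((e * L / (24 * V\<^sup>2)) * (2 / n) ^ 3)"
      using nz by (simp add: power2_eq_square power3_eq_cube mult_ac)
    also have "e * L / (24 * V\<^sup>2) = real (K choose 3) * h3 v K S d"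
      using choose_3_h3[OF K, of v S d] by (simp add: e_def V_def L_def)
    finally show ?thesis using eq unfolding 3 hr_def by (simp add: n_def mult_ac)
  qed
qed

text \<open>A permutation of the attributes that carries \<open>T\<close> onto \<open>T'\<close>
  permutes the shapes and transports \<open>rho\<close> along with them.\<close>

lemma contrast_card_cong:
  assumes T: "T \<subseteq> {..<K}" "T' \<subseteq> {..<K}" "card T = card T'"
  shows "contrast v K S d T = contrast v K S d T'"
proof -
  have fin: "finite T" "finite T'" using T by (auto intro: finite_subset)
  obtain g1 where g1: "bij_betw g1 T T'"
    using finite_same_card_bij[OF fin T(3)] by blast
  obtain g2 where g2: "bij_betw g2 ({..<K} - T) ({..<K} - T')"
    using finite_same_card_bij[of "{..<K} - T" "{..<K} - T'"] T fin by (auto simp: card_Diff_subset)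
  \<comment> \<open>Gluing a bijection of \<open>T\<close> with \<open>T'\<close> to one of their
    complements gives a permutation of all attributes.\<close>
  define f where "f k = (if k \<in> T then g1 k else g2 k)" for k
  have fT: "bij_betw f T T'" using g1 by (simp add: f_def cong: bij_betw_cong)
  have fC: "bij_betw f ({..<K} - T) ({..<K} - T')" using g2 bij_betw_cong[of "{..<K} - T" f g2] by (simp add: f_def)
  have "bij_betw f (T \<union> ({..<K} - T)) (T' \<union> ({..<K} - T'))"
    by (rule bij_betw_combine[OF fT fC]) auto
  moreover have "T \<union> ({..<K} - T) = {..<K}" "T' \<union> ({..<K} - T') = {..<K}" using T by auto
  ultimately have f: "bij_betw f {..<K} {..<K}" by simp
  then have inj: "inj_on f {..<K}" and im: "f ` {..<K} = {..<K}" by (auto simp: bij_betw_def)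
  have mem: "f k \<in> f ` A \<longleftrightarrow> k \<in> A" if "k < K" "A \<subseteq> {..<K}" for k A
    using inj_on_image_mem_iff[OF inj, of k A] that by simp
  let ?F = "\<lambda>(A, D). (f ` A, f ` D)"
  have injF: "inj_on ?F (shapes K S d)"
  proof (rule inj_onI, clarify)
    fix A D A' D' assume "(A, D) \<in> shapes K S d" "(A', D') \<in> shapes K S d" and eq: "f ` A = f ` A'" "f ` D = f ` D'"
    then have "A \<subseteq> {..<K}" "A' \<subseteq> {..<K}" "D \<subseteq> {..<K}" "D' \<subseteq> {..<K}" by (auto simp: shapes_def)
    then show "A = A' \<and> D = D'" using eq inj_on_image_eq_iff[OF inj] by simp
  qed
  have "?F ` shapes K S d \<subseteq> shapes K S d"
  proof clarify
    fix A D assume "(A, D) \<in> shapes K S d"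
    then have sh: "D \<subseteq> A" "A \<subseteq> {..<K}" "card A = S" "card D = d" by (auto simp: shapes_def)
    have "inj_on f A" "inj_on f D" using inj sh by (auto intro: inj_on_subset)
    then have "card (f ` A) = S" "card (f ` D) = d" using sh by (simp_all add: card_image)
    moreover have "f ` A \<subseteq> {..<K}" using im sh by blast
    ultimately show "(f ` A, f ` D) \<in> shapes K S d" using sh by (auto simp: shapes_def)
  qed
  then have imF: "?F ` shapes K S d = shapes K S d"
    using injF by (intro endo_inj_surj) auto
  have rho: "(\<Prod>k\<in>T'. rho v (f ` A) (f ` D) k) = (\<Prod>k\<in>T. rho v A D k)"
    if "A \<subseteq> {..<K}" "D \<subseteq> {..<K}" for A D
  proof -
    have "(\<Prod>k\<in>T'. rho v (f ` A) (f ` D) k) = (\<Prod>k\<in>T. rho v (f ` A) (f ` D) (f k))"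
      by (rule prod.reindex_bij_betw[OF fT, symmetric])
    also have "\<dots> = (\<Prod>k\<in>T. rho v A D k)"
      using T that by (intro prod.cong refl) (auto simp: rho_def mem subset_iff)
    finally show ?thesis .
  qed
  have "contrast v K S d T' = (\<Sum>(A, D)\<in>?F ` shapes K S d. (\<Prod>k\<in>T'. rho v A {} k) - (\<Prod>k\<in>T'. rho v A D k))"
    unfolding contrast_def imF ..
  also have "\<dots> = (\<Sum>(A, D)\<in>shapes K S d. (\<Prod>k\<in>T'. rho v (f ` A) {} k) - (\<Prod>k\<in>T'. rho v (f ` A) (f ` D) k))"
    by (subst sum.reindex[OF injF]) (simp add: case_prod_unfold)
  also have "\<dots> = contrast v K S d T"
    unfolding contrast_def
  proof (intro sum.cong refl, clarify)
    fix A D assume "(A, D) \<in> shapes K S d"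
    then have "A \<subseteq> {..<K}" "D \<subseteq> {..<K}" by (auto simp: shapes_def)
    then show "(\<Prod>k\<in>T'. rho v (f ` A) {} k) - (\<Prod>k\<in>T'. rho v (f ` A) (f ` D) k)
        = (\<Prod>k\<in>T. rho v A {} k) - (\<Prod>k\<in>T. rho v A D k)"
      using rho[of A D] rho[of A "{}"] by simp
  qed
  finally show ?thesis ..
qed

text \<open>For a single shape the product of \<open>rho\<close> over \<open>T\<close> depends on
  how \<open>T\<close> meets \<open>A\<close> and \<open>D\<close>. Summing over all supports of the
  size of \<open>T\<close> and exchanging the sums gives differences of \<open>esym\<close>, which
  are the same for every shape.\<close>

lemma contrast_value:
  assumes v: "v \<ge> 2" and K: "K \<ge> 3" and T: "T \<subseteq> {..<K}" and r: "card T \<in> {1..3}"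
  shows "2 * contrast v K S d T
     = real (card (shapes K S d)) * ((2 / (real v - 1)) ^ card T * hr (card T) v K S d)"
proof -
  let ?r = "card T" and ?TT = "{T'. T' \<subseteq> {..<K} \<and> card T' = card T}"
  have "card ?TT = K choose ?r" using n_subsets[of "{..<K}" ?r] by simp
  then have "real (K choose ?r) * (2 * contrast v K S d T) = (\<Sum>T'\<in>?TT. 2 * contrast v K S d T)" by simp
  also have "\<dots> = (\<Sum>T'\<in>?TT. 2 * contrast v K S d T')"
    using T by (intro sum.cong refl arg_cong[of _ _ "(*) 2"] contrast_card_cong) auto
  also have "\<dots> = (\<Sum>T'\<in>?TT. \<Sum>AD\<in>shapes K S d.
      2 * ((\<Prod>k\<in>T'. rho v (fst AD) {} k) - (\<Prod>k\<in>T'. rho v (fst AD) (snd AD) k)))"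
    by (simp add: contrast_def sum_distrib_left case_prod_unfold)
  also have "\<dots> = (\<Sum>AD\<in>shapes K S d. \<Sum>T'\<in>?TT.
      2 * ((\<Prod>k\<in>T'. rho v (fst AD) {} k) - (\<Prod>k\<in>T'. rho v (fst AD) (snd AD) k)))"
    by (rule sum.swap)
  also have "\<dots> = (\<Sum>AD\<in>shapes K S d. 2 * (esym {..<K} (rho v (fst AD) {}) ?r - esym {..<K} (rho v (fst AD) (snd AD)) ?r))"
    by (simp add: esym_def sum_subtractf flip: sum_distrib_left)
  also have "\<dots> = (\<Sum>AD\<in>shapes K S d. real (K choose ?r) * (2 / (real v - 1)) ^ ?r * hr ?r v K S d)"
    by (intro sum.cong refl esym_contrast[OF v K _ r]) auto
  also have "\<dots> = real (K choose ?r) * (real (card (shapes K S d)) * ((2 / (real v - 1)) ^ ?r * hr ?r v K S d))"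
    by simp
  finally have "real (K choose ?r) * (2 * contrast v K S d T)
    = real (K choose ?r) * (real (card (shapes K S d)) * ((2 / (real v - 1)) ^ ?r * hr ?r v K S d))" .
  \<comment> \<open>\<open>T\<close> itself is a subset of this size, so the binomial coefficient
    can be cancelled.\<close>
  moreover have "real (K choose ?r) \<noteq> 0"
    using card_mono[OF _ T] by simp
  ultimately show ?thesis by (metis mult_left_cancel)
qed

section \<open>Averages over the uniform and the invariant designs\<close>

lemma card_shapes_pos:
  assumes "d \<le> S" "S \<le> K"
  shows "card (shapes K S d) > 0"
proof -
  have "({..<S}, {..<d}) \<in> shapes K S d" using assms by (auto simp: shapes_def)
  then show ?thesis by (auto simp: card_gt_0_iff)
qed

lemma finite_region: "finite (region v K S)"
proof (rule finite_subset)
  show "region v K S \<subseteq> profiles v K \<times> profiles v K" by (auto simp: region_def)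
  have "finite (profiles v K)"
    unfolding profiles_def using finite_lists_length_eq[of "{0..v}" K] by (simp add: conj_commute)
  then show "finite (profiles v K \<times> profiles v K)" by simp
qed

text \<open>The common cell size cancels against the cardinality of the region, and the number of
  shapes cancels against the factor in \<open>contrast_value\<close>.\<close>

lemma unif_d_average:
  assumes v: "v \<ge> 2" and K: "K \<ge> 3" and d: "d \<le> S" "S \<le> K"
    and u: "u \<in> labels v K" "u' \<in> labels v K"
  shows "(\<Sum>x\<in>region v K S. unif_d v K S d x * ((effect v K (fst x) u - effect v K (snd x) u)
        * (effect v K (fst x) u' - effect v K (snd x) u')))
     = (2 / (real v - 1)) ^ card (supp K u) * hr (card (supp K u)) v K S d * (\<Prod>k<K. gram (u k) (u' k))"
proof -
  let ?g = "\<lambda>x. (effect v K (fst x) u - effect v K (snd x) u) * (effect v K (fst x) u' - effect v K (snd x) u')"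
  have r: "card (supp K u) \<in> {1..3}" using u by (simp add: labels_def)
  have lt: "u k < v" "u' k < v" if "k < K" for k using u that by (auto simp: labels_def)
  have nz: "real v ^ S * (real v - 1) ^ d \<noteq> 0" "real (card (shapes K S d)) \<noteq> 0"
    using v card_shapes_pos[OF d] by auto
  have "(\<Sum>x\<in>region v K S. unif_d v K S d x * ?g x) = (\<Sum>x\<in>region_d v K S d. unif_d v K S d x * ?g x)"
    by (rule sum.mono_neutral_right) (auto simp: finite_region region_d_def unif_d_def)
  also have "\<dots> = (\<Sum>x\<in>region_d v K S d. ?g x) / real (card (region_d v K S d))"
    unfolding sum_divide_distrib by (rule sum.cong) (auto simp: unif_d_def)
  also have "(\<Sum>x\<in>region_d v K S d. ?g x) = real v ^ S * (real v - 1) ^ d * (2 * contrast v K S d (supp K u))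
      * (\<Prod>k<K. gram (u k) (u' k))"
    by (rule sum_region_d_gg[OF v]) (use lt in auto)
  also have "\<dots> / real (card (region_d v K S d))
      = (2 * contrast v K S d (supp K u)) * (\<Prod>k<K. gram (u k) (u' k)) / real (card (shapes K S d))"
    unfolding card_region_d[OF v] using v by (simp add: divide_simps)
  finally show ?thesis
    unfolding contrast_value[OF v K supp_subset r] using nz by simp
qed

lemma inv_design_average:
  assumes v: "v \<ge> 2" and K: "K \<ge> 3" and S: "S \<le> K"
    and u: "u \<in> labels v K" "u' \<in> labels v K"
  shows "(\<Sum>x\<in>region v K S. inv_design v K S w x * (effect v K (fst x) u - effect v K (snd x) u)
        * (effect v K (fst x) u' - effect v K (snd x) u'))
     = (2 / (real v - 1)) ^ card (supp K u) * hbar (hr (card (supp K u))) v K S w * (\<Prod>k<K. gram (u k) (u' k))"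
proof -
  let ?g = "\<lambda>x. (effect v K (fst x) u - effect v K (snd x) u) * (effect v K (fst x) u' - effect v K (snd x) u')"
  have "(\<Sum>x\<in>region v K S. inv_design v K S w x * (effect v K (fst x) u - effect v K (snd x) u)
        * (effect v K (fst x) u' - effect v K (snd x) u'))
     = (\<Sum>x\<in>region v K S. \<Sum>d=1..S. w d * (unif_d v K S d x * ?g x))"
    by (simp add: inv_design_def sum_distrib_right mult.assoc)
  also have "\<dots> = (\<Sum>d=1..S. \<Sum>x\<in>region v K S. w d * (unif_d v K S d x * ?g x))"
    by (rule sum.swap)
  also have "\<dots> = (\<Sum>d=1..S. w d * ((2 / (real v - 1)) ^ card (supp K u) * hr (card (supp K u)) v K S d * (\<Prod>k<K. gram (u k) (u' k))))"
    unfolding sum_distrib_left[symmetric] using unif_d_average[OF v K _ S u] by (intro sum.cong refl) simp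
  also have "\<dots> = (2 / (real v - 1)) ^ card (supp K u) * hbar (hr (card (supp K u))) v K S w * (\<Prod>k<K. gram (u k) (u' k))"
    by (simp add: hbar_def sum_distrib_left sum_distrib_right mult_ac)
  finally show ?thesis .
qed

section \<open>The inverse information matrix and the variance function\<close>

text \<open>Bordered at index 0 in the same way as \<open>gram\<close>, so that products over the
  attributes stay inverse to each other.\<close>

definition gram_inv :: "nat \<Rightarrow> nat \<Rightarrow> nat \<Rightarrow> real" where
  "gram_inv v p q = (if p = 0 \<and> q = 0 then 1 else if p = 0 \<or> q = 0 then 0
     else if p = q then 1 - 1 / real v else - 1 / real v)"

text \<open>On the nonzero indices J^2 = (v - 1) J, so (I + J)(I - J/v) = I + J - J/v - (v - 1) J/v
  = I.\<close>

lemma sum_gram_gram_inv: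
  assumes "v \<ge> 1" "p < v" "q < v"
  shows "(\<Sum>b<v. gram p b * gram_inv v b q) = (if p = q then 1 else 0)"
proof -
  have "{..<v} = insert 0 {1..<v}" using assms by auto
  then have "(\<Sum>b<v. gram p b * gram_inv v b q) = gram p 0 * gram_inv v 0 q + (\<Sum>b=1..<v. gram p b * gram_inv v b q)"
    by simp
  also have "(\<Sum>b=1..<v. gram p b * gram_inv v b q)
      = (if p = 0 \<or> q = 0 then 0 else \<Sum>b=1..<v. (1 + (if b = p then 1 else 0)) * ((if b = q then 1 else 0) - 1 / real v))"
    by (auto simp: gram_def gram_inv_def intro!: sum.cong sum.neutral)
  also have "(\<Sum>b=1..<v. (1 + (if b = p then 1 else 0)) * ((if b = q then 1 else 0) - 1 / real v))
      = (\<Sum>b=1..<v. (if b = q then 1 else 0)) - (\<Sum>b=1..<v. 1 / real v)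
        + (\<Sum>b=1..<v. if b = p then (if p = q then 1 else 0) - 1 / real v else 0)"
    unfolding sum_subtractf[symmetric] sum.distrib[symmetric] by (rule sum.cong) (auto simp: algebra_simps)
  finally show ?thesis
    using assms by (auto simp: gram_def gram_inv_def field_simps of_nat_diff)
qed

text \<open>In the inner product of I - J/v the levels 1 to v are the vertices of a regular simplex
  centred at the origin. The values are v - 1 times those of \<open>rho\<close>, which is why the
  variance function meets the same symmetric polynomials as the moments.\<close>

lemma sum_lev_gram_inv_lev:
  assumes v: "v \<ge> 2" and x: "x \<le> v" "y \<le> v"
  shows "(\<Sum>b=1..<v. (\<Sum>a<v. lev v x a * gram_inv v a b) * lev v y b)
     = (if x = 0 \<or> y = 0 then 0 else if x = y then (real v - 1) / real v else - 1 / real v)"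
proof -
  have row: "(\<Sum>a<v. lev v x a * gram_inv v a b)
      = (if x = 0 then 0 else if x = v then - 1 / real v else (if x = b then 1 else 0) - 1 / real v)"
    if b: "b \<in> {1..<v}" for b
  proof -
    have "{..<v} = insert 0 {1..<v}" using v by auto
    then have "(\<Sum>a<v. lev v x a * gram_inv v a b) = (\<Sum>a=1..<v. lev v x a * gram_inv v a b)"
      using b by (simp add: gram_inv_def)
    also have "\<dots> = (\<Sum>a=1..<v. if x = v then (if a = b then -1 else 0) + 1 / real v
        else if a = x then (if x = b then 1 else 0) - 1 / real v else 0)"
      using b by (intro sum.cong) (auto simp: lev_def gram_inv_def)
    also have "\<dots> = (if x = 0 then 0 else if x = v then - 1 / real v else (if x = b then 1 else 0) - 1 / real v)"
    proof (cases "x = v")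
      case True
      then show ?thesis using b v by (simp add: sum.distrib of_nat_diff) (simp add: field_simps)
    qed (use b x in simp)
    finally show ?thesis .
  qed
  have "(\<Sum>b=1..<v. (\<Sum>a<v. lev v x a * gram_inv v a b) * lev v y b)
      = (\<Sum>b=1..<v. (if x = 0 then 0 else if x = v then - 1 / real v else (if x = b then 1 else 0) - 1 / real v)
          * (if y = v then -1 else if y = b then 1 else 0))"
    by (intro sum.cong refl) (simp only: row, simp add: lev_def)
  also have "\<dots> = (if x = 0 \<or> y = 0 then 0 else if x = y then (real v - 1) / real v else - 1 / real v)"
  proof (cases "x = 0")
    case False
    show ?thesis
    proof (cases "y = v")
      case True
      have "(\<Sum>b=1..<v. (if x = 0 then 0 else if x = v then - 1 / real v else (if x = b then 1 else 0) - 1 / real v)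
          * (if y = v then -1 else if y = b then 1 else 0))
        = (\<Sum>b=1..<v. 1 / real v) - (\<Sum>b=1..<v. if b = x then 1 else 0)"
        unfolding sum_subtractf[symmetric] using False True by (intro sum.cong) auto
      also have "\<dots> = (real v - 1) / real v - (if x = v then 0 else 1)"
        using False v x by (simp add: of_nat_diff)
      finally show ?thesis using False True v by (simp add: diff_divide_distrib)
    next
      case y: False
      have "(\<Sum>b=1..<v. (if x = 0 then 0 else if x = v then - 1 / real v else (if x = b then 1 else 0) - 1 / real v)
          * (if y = v then -1 else if y = b then 1 else 0))
        = (\<Sum>b=1..<v. if b = y then (if x = v then - 1 / real v else (if x = y then 1 else 0) - 1 / real v) else 0)"
        using False y by (intro sum.cong) auto
      also have "\<dots> = (if y = 0 then 0 else if x = v then - 1 / real v else (if x = y then 1 else 0) - 1 / real v)"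
        using y x by simp
      finally show ?thesis using False y v by (auto simp: diff_divide_distrib)
    qed
  qed simp
  finally show ?thesis .
qed

text \<open>The zeros in the border force equal supports. This permits extending sums over
  \<open>labels\<close> to the full function space, where they factorise.\<close>

lemma prod_nonzero_supp:
  assumes "(\<Prod>k<K. G (u k) (u' k)) \<noteq> (0::real)"
    and "\<And>a. a \<noteq> 0 \<Longrightarrow> G 0 a = 0" "\<And>a. a \<noteq> 0 \<Longrightarrow> G a 0 = 0"
  shows "supp K u = supp K u'"
proof -
  have "G (u k) (u' k) \<noteq> 0" if "k < K" for k using assms(1) that by auto
  then have "u k \<noteq> 0 \<longleftrightarrow> u' k \<noteq> 0" if "k < K" for k using assms(2,3) that by metis
  then show ?thesis unfolding supp_def by blast
qed

text \<open>A function outside \<open>labels\<close> cannot share the support of \<open>u\<close>,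
  so its term is 0. The extended sum is a product of entries of the one-attribute identity
  matrix.\<close>

lemma sum_labels_gram_gram_inv:
  assumes v: "v \<ge> 1" and u: "u \<in> labels v K" "u'' \<in> labels v K"
  shows "(\<Sum>u'\<in>labels v K. (\<Prod>k<K. gram (u k) (u' k)) * (\<Prod>k<K. gram_inv v (u' k) (u'' k)))
     = (if u = u'' then 1 else 0)"
proof -
  let ?E = "{..<K} \<rightarrow>\<^sub>E {..<v}"
  have uE: "u \<in> ?E" "u'' \<in> ?E" using u by (auto simp: labels_def)
  have "(\<Sum>u'\<in>labels v K. (\<Prod>k<K. gram (u k) (u' k)) * (\<Prod>k<K. gram_inv v (u' k) (u'' k)))
      = (\<Sum>u'\<in>?E. (\<Prod>k<K. gram (u k) (u' k)) * (\<Prod>k<K. gram_inv v (u' k) (u'' k)))"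
  proof (rule sum.mono_neutral_left)
    show "\<forall>u'\<in>?E - labels v K. (\<Prod>k<K. gram (u k) (u' k)) * (\<Prod>k<K. gram_inv v (u' k) (u'' k)) = 0"
    proof (rule ballI, rule ccontr)
      fix u' assume u': "u' \<in> ?E - labels v K"
        and nz: "(\<Prod>k<K. gram (u k) (u' k)) * (\<Prod>k<K. gram_inv v (u' k) (u'' k)) \<noteq> 0"
      have "supp K u = supp K u'"
        by (rule prod_nonzero_supp[of gram]) (use nz in \<open>auto simp: gram_def\<close>)
      then show False using u' u(1) by (simp add: labels_def)
    qed
  qed (auto simp: labels_def intro!: finite_PiE)
  also have "\<dots> = (\<Prod>k<K. \<Sum>b<v. gram (u k) b * gram_inv v b (u'' k))"
    unfolding prod.distrib[symmetric]
    by (rule prod_sum_PiE[of "{..<K}" "\<lambda>_. {..<v}" "\<lambda>k b. gram (u k) b * gram_inv v b (u'' k)", symmetric]) auto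
  also have "\<dots> = (\<Prod>k<K. if u k = u'' k then 1 else 0)"
    using uE by (intro prod.cong refl sum_gram_gram_inv[OF v]) auto
  also have "\<dots> = (if u = u'' then 1 else 0)"
  proof (cases "u = u''")
    case False
    then obtain k where k: "u k \<noteq> u'' k" by auto
    then have "k \<in> {..<K}" using uE by (metis PiE_arb)
    then show ?thesis using False k by (simp add: prod_zero_iff) blast
  qed simp
  finally show ?thesis .
qed

text \<open>The weight depends only on the second label, so the sum over the first extends to all
  functions and factorises; the sum over the second is then of the form treated in
  \<open>sum_labels_by_support\<close>.\<close>

lemma sum_effect_gram_inv_effect:
  assumes v: "v \<ge> 2" and x: "\<And>k. k < K \<Longrightarrow> x ! k \<le> v" "\<And>k. k < K \<Longrightarrow> y ! k \<le> v"
  shows "(\<Sum>u\<in>labels v K. \<Sum>u'\<in>labels v K. effect v K x u *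
        (C (card (supp K u')) * (\<Prod>k<K. gram_inv v (u k) (u' k)) * effect v K y u'))
     = (\<Sum>r=1..3. C r * esym {..<K} (\<lambda>k. if x ! k = 0 \<or> y ! k = 0 then 0
         else if x ! k = y ! k then (real v - 1) / real v else - 1 / real v) r)"
proof -
  let ?E = "{..<K} \<rightarrow>\<^sub>E {..<v}"
  have inner: "(\<Sum>u\<in>labels v K. effect v K x u * (\<Prod>k<K. gram_inv v (u k) (u' k)))
      = (\<Prod>k<K. \<Sum>a<v. lev v (x ! k) a * gram_inv v a (u' k))" if u': "u' \<in> labels v K" for u'
  proof -
    have "(\<Sum>u\<in>labels v K. effect v K x u * (\<Prod>k<K. gram_inv v (u k) (u' k)))
       = (\<Sum>u\<in>?E. effect v K x u * (\<Prod>k<K. gram_inv v (u k) (u' k)))"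
    proof (rule sum.mono_neutral_left)
      show "\<forall>u\<in>?E - labels v K. effect v K x u * (\<Prod>k<K. gram_inv v (u k) (u' k)) = 0"
      proof (rule ballI, rule ccontr)
        fix u assume u: "u \<in> ?E - labels v K" and nz: "effect v K x u * (\<Prod>k<K. gram_inv v (u k) (u' k)) \<noteq> 0"
        have "supp K u = supp K u'"
          by (rule prod_nonzero_supp[of "gram_inv v"]) (use nz in \<open>auto simp: gram_inv_def\<close>)
        then show False using u u' by (simp add: labels_def)
      qed
    qed (auto simp: labels_def intro!: finite_PiE)
    also have "\<dots> = (\<Prod>k<K. \<Sum>a<v. lev v (x ! k) a * gram_inv v a (u' k))"
      unfolding effect_def prod.distrib[symmetric]
      by (rule prod_sum_PiE[of "{..<K}" "\<lambda>_. {..<v}" "\<lambda>k a. lev v (x ! k) a * gram_inv v a (u' k)", symmetric]) auto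
    finally show ?thesis .
  qed
  define \<theta> where "\<theta> k b = (\<Sum>a<v. lev v (x ! k) a * gram_inv v a b) * lev v (y ! k) b" for k b
  have \<theta>0: "\<theta> k 0 = 1" for k
  proof -
    have "{..<v} = insert 0 {1..<v}" using v by auto
    then show ?thesis by (simp add: \<theta>_def gram_inv_def lev_def)
  qed
  have "(\<Sum>u\<in>labels v K. \<Sum>u'\<in>labels v K. effect v K x u *
        (C (card (supp K u')) * (\<Prod>k<K. gram_inv v (u k) (u' k)) * effect v K y u'))
     = (\<Sum>u'\<in>labels v K. \<Sum>u\<in>labels v K. effect v K x u *
        (C (card (supp K u')) * (\<Prod>k<K. gram_inv v (u k) (u' k)) * effect v K y u'))"
    by (rule sum.swap)
  also have "\<dots> = (\<Sum>u'\<in>labels v K. C (card (supp K u')) *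
       ((\<Sum>u\<in>labels v K. effect v K x u * (\<Prod>k<K. gram_inv v (u k) (u' k))) * effect v K y u'))"
    by (intro sum.cong refl) (simp add: sum_distrib_left sum_distrib_right mult_ac)
  also have "\<dots> = (\<Sum>u'\<in>labels v K. C (card (supp K u')) * (\<Prod>k<K. \<theta> k (u' k)))"
    by (intro sum.cong refl) (simp only: inner effect_def[of v K y] \<theta>_def prod.distrib)
  also have "\<dots> = (\<Sum>r=1..3. C r * esym {..<K} (\<lambda>k. \<Sum>b=1..<v. \<theta> k b) r)"
    using v \<theta>0 by (intro sum_labels_by_support) auto
  also have "\<dots> = (\<Sum>r=1..3. C r * esym {..<K} (\<lambda>k. if x ! k = 0 \<or> y ! k = 0 then 0
         else if x ! k = y ! k then (real v - 1) / real v else - 1 / real v) r)"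
    unfolding \<theta>_def esym_def
    by (intro sum.cong refl arg_cong[of _ _ "(*) _"] prod.cong sum_lev_gram_inv_lev v x) auto
  finally show ?thesis .
qed

section \<open>Value of the variance function as a sum over labels\<close>

lemma esym_scale: "esym B (\<lambda>k. c * x k) r = c ^ r * esym B x r"
  unfolding esym_def sum_distrib_left by (intro sum.cong) (auto simp: prod.distrib)

lemma esym_cong: "(\<And>k. k \<in> B \<Longrightarrow> x k = y k) \<Longrightarrow> esym B x r = esym B y r"
  unfolding esym_def by (intro sum.cong prod.cong) auto

text \<open>Expand into four quadratic forms. At each attribute the inner product is v - 1 times
  \<open>rho\<close>, with \<open>D\<close> empty for the two pure forms; the resulting (v - 1)^r
  cancels the denominator in \<open>esym_contrast\<close>. Only \<open>d\<close> remains of the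
  pair, whence the constancy on \<open>region_d\<close>.\<close>

lemma variance_sum:
  assumes v: "v \<ge> 2" and K: "K \<ge> 3" and x: "x \<in> region_d v K S d"
  shows "(\<Sum>u\<in>labels v K. \<Sum>u'\<in>labels v K. (effect v K (fst x) u - effect v K (snd x) u) *
        (C (card (supp K u')) * (\<Prod>k<K. gram_inv v (u k) (u' k)) * (effect v K (fst x) u' - effect v K (snd x) u')))
     = (\<Sum>r=1..3. C r * (real (K choose r) * 2 ^ r * hr r v K S d))"
proof -
  obtain i j where ij: "x = (i, j)" by (cases x)
  note R = x[unfolded ij region_d_iff]
  define A D where "A = {k. k < K \<and> i ! k \<noteq> 0}" and "D = {k. k < K \<and> i ! k \<noteq> j ! k}"
  have AD: "(A, D) \<in> shapes K S d" using R by (auto simp: shapes_def A_def D_def)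
  let ?Q = "\<lambda>x y. \<Sum>u\<in>labels v K. \<Sum>u'\<in>labels v K. effect v K x u *
        (C (card (supp K u')) * (\<Prod>k<K. gram_inv v (u k) (u' k)) * effect v K y u')"
  let ?e = "\<lambda>D r. (real v - 1) ^ r * esym {..<K} (rho v A D) r"
  have Q: "?Q y z = (\<Sum>r=1..3. C r * ?e D' r)"
    if b: "\<And>k. k < K \<Longrightarrow> y ! k \<le> v" "\<And>k. k < K \<Longrightarrow> z ! k \<le> v"
      and c: "\<And>k. k < K \<Longrightarrow> (if y ! k = 0 \<or> z ! k = 0 then 0
         else if y ! k = z ! k then (real v - 1) / real v else - 1 / real v) = (real v - 1) * rho v A D' k" for y z D'
  proof -
    have "?Q y z = (\<Sum>r=1..3. C r * esym {..<K} (\<lambda>k. if y ! k = 0 \<or> z ! k = 0 then 0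
         else if y ! k = z ! k then (real v - 1) / real v else - 1 / real v) r)"
      using b by (intro sum_effect_gram_inv_effect v)
    also have "\<dots> = (\<Sum>r=1..3. C r * ?e D' r)"
    proof (rule sum.cong[OF refl])
      fix r :: nat
      have "esym {..<K} (\<lambda>k. if y ! k = 0 \<or> z ! k = 0 then 0
         else if y ! k = z ! k then (real v - 1) / real v else - 1 / real v) r
         = esym {..<K} (\<lambda>k. (real v - 1) * rho v A D' k) r"
        by (rule esym_cong) (rule c, simp)
      then show "C r * esym {..<K} (\<lambda>k. if y ! k = 0 \<or> z ! k = 0 then 0
         else if y ! k = z ! k then (real v - 1) / real v else - 1 / real v) r = C r * ?e D' r"
        by (simp only: esym_scale)
    qed
    finally show ?thesis .
  qed
  have v1: "real v - 1 \<noteq> 0" "real v \<noteq> 0" using v by auto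
  have bnd: "i ! k \<le> v" "j ! k \<le> v" if "k < K" for k using R that by auto
  have act: "i ! k = 0 \<longleftrightarrow> k \<notin> A" "j ! k = 0 \<longleftrightarrow> k \<notin> A" if "k < K" for k
    using R that by (auto simp: A_def)
  have dif: "i ! k = j ! k \<longleftrightarrow> k \<notin> D" "j ! k = i ! k \<longleftrightarrow> k \<notin> D" if "k < K" for k
    using that by (auto simp: D_def)
  have DA: "k \<in> A" if "k \<in> D" for k using AD that by (auto simp: shapes_def)
  have ii: "?Q i i = (\<Sum>r=1..3. C r * ?e {} r)"
    by (rule Q) (use v1 in \<open>simp_all add: bnd act rho_def\<close>)
  have jj: "?Q j j = (\<Sum>r=1..3. C r * ?e {} r)"
    by (rule Q) (use v1 in \<open>simp_all add: bnd act rho_def\<close>)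
  have ij': "?Q i j = (\<Sum>r=1..3. C r * ?e D r)"
    by (rule Q) (use v1 in \<open>simp_all add: bnd act dif DA rho_def\<close>)
  have ji: "?Q j i = (\<Sum>r=1..3. C r * ?e D r)"
    by (rule Q) (use v1 in \<open>simp_all add: bnd act dif DA rho_def\<close>)
  have "(\<Sum>u\<in>labels v K. \<Sum>u'\<in>labels v K. (effect v K (fst x) u - effect v K (snd x) u) *
        (C (card (supp K u')) * (\<Prod>k<K. gram_inv v (u k) (u' k)) * (effect v K (fst x) u' - effect v K (snd x) u')))
      = ?Q i i - ?Q i j - ?Q j i + ?Q j j"
    unfolding sum_subtractf[symmetric] sum.distrib[symmetric] ij
    by (intro sum.cong refl) (simp add: algebra_simps)
  also have "\<dots> = (\<Sum>r=1..3. C r * ?e {} r - C r * ?e D r - C r * ?e D r + C r * ?e {} r)"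
    unfolding ii jj ij' ji by (simp only: sum_subtractf sum.distrib)
  also have "\<dots> = (\<Sum>r=1..3. C r * ((real v - 1) ^ r * (2 * (esym {..<K} (rho v A {}) r - esym {..<K} (rho v A D) r))))"
    by (intro sum.cong refl) (simp add: algebra_simps)
  also have "\<dots> = (\<Sum>r=1..3. C r * (real (K choose r) * 2 ^ r * hr r v K S d))"
  proof (intro sum.cong refl arg_cong[of _ _ "(*) _"])
    fix r :: nat assume r: "r \<in> {1..3}"
    show "(real v - 1) ^ r * (2 * (esym {..<K} (rho v A {}) r - esym {..<K} (rho v A D) r))
       = real (K choose r) * 2 ^ r * hr r v K S d"
      unfolding esym_contrast[OF v K AD r] using v1 by (simp add: power_divide)
  qed
  finally show ?thesis .
qed

section \<open>From sums over labels to matrices\<close>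

lemma dim_gvec: "dim_vec (gvec v K x) = pdim v K"
  by (simp add: gvec_def fvec_label_list length_label_list)

theorem theorem2:
  fixes v K S :: nat and w :: "nat \<Rightarrow> real"
  assumes "v \<ge> 2" and "K \<ge> 3" and "3 \<le> S" and "S \<le> K"
    and "\<forall>d\<in>{1..S}. w d \<ge> 0" and "(\<Sum>d=1..S. w d) = 1"
    and "hbar h1 v K S w > 0" and "hbar h2 v K S w > 0" and "hbar h3 v K S w > 0"
  shows "invertible_mat (info_mat v K S (inv_design v K S w)) \<and>
    (\<forall>Minv. inverts_mat (info_mat v K S (inv_design v K S w)) Minv \<and>
             inverts_mat Minv (info_mat v K S (inv_design v K S w)) \<longrightarrow>
      (\<forall>d\<in>{1..S}. \<forall>x\<in>region_d v K S d.
         gvec v K x \<bullet> (Minv *\<^sub>v gvec v K x) =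
         real d * (real v - 1) *
           (1 / hbar h1 v K S w
            + (real v - 1) / (4 * real v * hbar h2 v K S w)
                * (2 * real S * real v - 2 * real S - real d * real v - real v + 2)
            + (real v - 1)^2 / (24 * (real v)^2 * hbar h3 v K S w) * lam v S d)))"
proof -
  define p where "p = pdim v K"
  define lb where "lb r = label_list v K ! r" for r
  define M where "M = info_mat v K S (inv_design v K S w)"
  define H where "H r = hbar (hr r) v K S w" for r
  \<comment> \<open>The reciprocal of the coefficient that \<open>inv_design_average\<close> gives
    for supports of size \<open>r\<close>.\<close>
  define C where "C r = ((real v - 1) / 2) ^ r / H r" for r
  \<comment> \<open>The weight can be read off the column label alone, because in a nonzero entry
    both labels have the same support.\<close>
  define N where "N = mat p p (\<lambda>(r, s). C (card (supp K (lb s))) * (\<Prod>k<K. gram_inv v (lb r k) (lb s k)))"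
  have v1: "v \<ge> 1" and rv: "real v - 1 \<noteq> 0" "real v \<noteq> 0" using assms(1) by auto
  have Hnz: "H r \<noteq> 0" if "r \<in> {1..3}" for r
    using assms(7-9) that by (auto simp: H_def hr_def)
  have lb: "lb r \<in> labels v K" if "r < p" for r
    using bij_betwE[OF bij_label_list[OF v1, of K]] that by (auto simp: lb_def p_def)
  have lb_inj: "lb r = lb s \<longleftrightarrow> r = s" if "r < p" "s < p" for r s
    using bij_label_list[OF v1, of K] that by (auto simp: lb_def p_def bij_betw_def inj_on_def)
  have gv: "gvec v K x $ r = effect v K (fst x) (lb r) - effect v K (snd x) (lb r)" if "r < p" for x r
    using gvec_label_list that by (simp add: p_def lb_def)
  have M: "M \<in> carrier_mat p p" by (simp add: M_def info_mat_def p_def)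
  have N: "N \<in> carrier_mat p p" by (simp add: N_def)
  have Mrs: "M $$ (r, s) = (2 / (real v - 1)) ^ card (supp K (lb r)) * H (card (supp K (lb r)))
      * (\<Prod>k<K. gram (lb r k) (lb s k))" if "r < p" "s < p" for r s
  proof -
    have "M $$ (r, s) = (\<Sum>x\<in>region v K S. inv_design v K S w x * (gvec v K x $ r) * (gvec v K x $ s))"
      using that by (simp add: M_def info_mat_def p_def)
    also have "\<dots> = (2 / (real v - 1)) ^ card (supp K (lb r)) * H (card (supp K (lb r)))
      * (\<Prod>k<K. gram (lb r k) (lb s k))"
      unfolding gv[OF that(1)] gv[OF that(2)] H_def
      by (rule inv_design_average[OF assms(1,2,4) lb[OF that(1)] lb[OF that(2)]])
    finally show ?thesis .
  qed
  have MN: "M * N = 1\<^sub>m p"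
  proof (rule eq_matI)
    fix r s assume "r < dim_row (1\<^sub>m p :: real mat)" "s < dim_col (1\<^sub>m p :: real mat)"
    then have r: "r < p" and s: "s < p" by simp_all
    let ?c = "\<lambda>r. (2 / (real v - 1)) ^ card (supp K (lb r)) * H (card (supp K (lb r)))"
    have "(M * N) $$ (r, s) = (\<Sum>t<p. M $$ (r, t) * N $$ (t, s))"
      using M N r s by (simp add: scalar_prod_def atLeast0LessThan)
    also have "\<dots> = (\<Sum>t<p. ?c r * C (card (supp K (lb s)))
        * ((\<Prod>k<K. gram (lb r k) (lb t k)) * (\<Prod>k<K. gram_inv v (lb t k) (lb s k))))"
      using r s by (intro sum.cong refl) (simp add: Mrs N_def)
    also have "\<dots> = ?c r * C (card (supp K (lb s)))
        * (\<Sum>t<p. (\<Prod>k<K. gram (lb r k) (lb t k)) * (\<Prod>k<K. gram_inv v (lb t k) (lb s k)))"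
      by (simp only: sum_distrib_left)
    also have "(\<Sum>t<p. (\<Prod>k<K. gram (lb r k) (lb t k)) * (\<Prod>k<K. gram_inv v (lb t k) (lb s k)))
        = (\<Sum>u'\<in>labels v K. (\<Prod>k<K. gram (lb r k) (u' k)) * (\<Prod>k<K. gram_inv v (u' k) (lb s k)))"
      unfolding p_def lb_def by (rule sum_label_list[OF v1])
    also have "\<dots> = (if r = s then 1 else 0)"
      unfolding sum_labels_gram_gram_inv[OF v1 lb[OF r] lb[OF s]] using lb_inj[OF r s] by simp
    also have "?c r * C (card (supp K (lb s))) * (if r = s then 1 else 0) = (1\<^sub>m p :: real mat) $$ (r, s)"
    proof (cases "r = s")
      case True
      have "card (supp K (lb s)) \<in> {1..3}" using lb[OF s] by (simp add: labels_def)
      then show ?thesis using True r s rv Hnz by (simp add: C_def power_divide)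
    qed (use r s in simp)
    finally show "(M * N) $$ (r, s) = (1\<^sub>m p :: real mat) $$ (r, s)" .
  qed (use M N in auto)
  have NM: "N * M = 1\<^sub>m p" by (rule mat_mult_left_right_inverse[OF M N MN])
  have inv: "invertible_mat M"
    using M N MN NM by (auto simp: invertible_mat_def inverts_mat_def square_mat.simps)
  have uniq: "Minv = N" if "inverts_mat M Minv" "inverts_mat Minv M" for Minv
  proof -
    \<comment> \<open>\<open>inverts_mat\<close> does not fix the dimensions of \<open>Minv\<close>;
      they follow from comparing the column counts in these two equations.\<close>
    have a: "M * Minv = 1\<^sub>m p" and b: "Minv * M = 1\<^sub>m (dim_row Minv)"
      using that M by (auto simp: inverts_mat_def)
    have "dim_col Minv = p" using arg_cong[OF a, of dim_col] by simp
    moreover have "dim_row Minv = p" using arg_cong[OF b, of dim_col] M by simp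
    ultimately have c: "Minv \<in> carrier_mat p p" by auto
    have "Minv = Minv * (M * N)" using MN c by simp
    also have "\<dots> = (Minv * M) * N" using assoc_mult_mat[OF c M N] by simp
    also have "\<dots> = N" using b c N by simp
    finally show ?thesis .
  qed
  have val: "gvec v K x \<bullet> (N *\<^sub>v gvec v K x) =
         real d * (real v - 1) *
           (1 / hbar h1 v K S w
            + (real v - 1) / (4 * real v * hbar h2 v K S w)
                * (2 * real S * real v - 2 * real S - real d * real v - real v + 2)
            + (real v - 1)^2 / (24 * (real v)^2 * hbar h3 v K S w) * lam v S d)"
    if x: "x \<in> region_d v K S d" for x d
  proof -
    let ?g = "\<lambda>u. effect v K (fst x) u - effect v K (snd x) u"
    let ?T = "\<lambda>u u'. ?g u * (C (card (supp K u')) * (\<Prod>k<K. gram_inv v (u k) (u' k)) * ?g u')"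
    have dg: "dim_vec (gvec v K x) = p" by (simp add: dim_gvec p_def)
    have "gvec v K x \<bullet> (N *\<^sub>v gvec v K x) = (\<Sum>r<p. gvec v K x $ r * (\<Sum>s<p. N $$ (r, s) * gvec v K x $ s))"
      using N dg by (simp add: scalar_prod_def atLeast0LessThan)
    also have "\<dots> = (\<Sum>r<p. \<Sum>s<p. ?T (lb r) (lb s))"
      unfolding sum_distrib_left by (intro sum.cong refl) (simp add: gv N_def)
    also have "\<dots> = (\<Sum>r<p. \<Sum>u'\<in>labels v K. ?T (lb r) u')"
      unfolding p_def lb_def by (intro sum.cong refl sum_label_list[OF v1])
    also have "\<dots> = (\<Sum>u\<in>labels v K. \<Sum>u'\<in>labels v K. ?T u u')"
      unfolding p_def lb_def by (rule sum_label_list[OF v1])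
    also have "\<dots> = (\<Sum>r=1..3. C r * (real (K choose r) * 2 ^ r * hr r v K S d))"
      by (rule variance_sum[OF assms(1,2) x])
    \<comment> \<open>The power of 1/2 in \<open>C\<close> cancels against the factor 2^r.\<close>
    also have "\<dots> = (\<Sum>r=1..3. (real v - 1) ^ r * (real (K choose r) * hr r v K S d) / H r)"
      by (intro sum.cong refl) (simp add: C_def power_divide)
    also have "\<dots> = (real v - 1) * (real K * h1 v K S d) / hbar h1 v K S w
        + (real v - 1)\<^sup>2 * (real (K choose 2) * h2 v K S d) / hbar h2 v K S w
        + (real v - 1) ^ 3 * (real (K choose 3) * h3 v K S d) / hbar h3 v K S w"
    proof -
      have "{1..3::nat} = {1, 2, 3}" by auto
      then show ?thesis by (simp add: H_def hr_def)
    qed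
    also have "real K * h1 v K S d = real d" using assms(2) by (simp add: h1_def)
    also have "real (K choose 2) * h2 v K S d
        = real d * (2 * real S * real v - 2 * real S - real d * real v - real v + 2) / (4 * real v)"
      using assms(2) by (intro choose_2_h2) simp
    also have "real (K choose 3) * h3 v K S d = real d * lam v S d / (24 * (real v)\<^sup>2)"
      by (rule choose_3_h3[OF assms(2)])
    \<comment> \<open>The common factor d (v - 1) is taken out, stated for arbitrary reals so that
      the brackets and the averages behave as atoms.\<close>
    also have "n * e / a + n\<^sup>2 * (e * B / (4 * V)) / b + n ^ 3 * (e * L / (24 * V\<^sup>2)) / c
        = e * n * (1 / a + n / (4 * V * b) * B + n\<^sup>2 / (24 * V\<^sup>2 * c) * L)" for n e a b c B V L :: real
      by (simp add: distrib_left power2_eq_square power3_eq_cube mult_ac)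
    finally show ?thesis .
  qed
  show ?thesis using inv uniq val unfolding M_def by blast
qed

end
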